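(* Let $n, p$ be integers with either $n \geq 3$ and $p \geq 2$, or $n = 2$ and $p \geq 4$. Let $G = \mathrm{GL}_p(\mathbb{C})$ act on $\mathcal{M}_p^n$ by simultaneous conjugation, and let $S \subseteq \mathbb{C}[\mathcal{M}_p^n]^G$ be a separating set. Then $|S| \geq (n-1)p^2 + p$.
   Context: $\mathcal{M}_p$ is the space of $p \times p$ complex matrices and $\mathcal{M}_p^n$ the space of $n$-tuples of such matrices. $G=\mathrm{GL}_p(\mathbb{C})$ acts by $g \cdot (A_1,\dots,A_n) = (gA_1g^{-1},\dots,gA_ng^{-1})$, and $\mathbb{C}[\mathcal{M}_p^n]^G$ is the algebra of polynomial functions on $\mathcal{M}_p^n$ that are constant on $G$-orbits. A subset $S \subseteq \mathbb{C}[\mathcal{M}_p^n]^G$ is a separating set if for all $v,w \in \mathcal{M}_p^n$: $s(v)=s(w)$ for all $s \in S$ if and only if $f(v)=f(w)$ for all $f \in \mathbb{C}[\mathcal{M}_p^n]^G$. *)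

theory Defs
  imports "HOL-Analysis.Analysis"
begin

text \<open>
  The number \<open>n\<close> of matrices and their size \<open>p\<close> are the cardinalities of the finite index types
  \<open>'n\<close> and \<open>'p\<close>: for \<open>A :: ('n, 'p) mat_tuple\<close>, the entry in row \<open>i\<close> and column \<open>j\<close> of the
  \<open>k\<close>-th matrix is \<open>A $ k $ i $ j\<close>.
\<close>

type_synonym ('n, 'p) mat_tuple = "complex ^ 'p ^ 'p ^ 'n"

definition GL :: "(complex ^ 'p ^ 'p) set" where
  "GL = {g. invertible g}"

definition sim_conj ::
    "complex ^ 'p ^ 'p \<Rightarrow> ('n::finite, 'p::finite) mat_tuple \<Rightarrow> ('n, 'p) mat_tuple" where
  "sim_conj g A = (\<chi> k. g ** (A $ k) ** matrix_inv g)"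

text \<open>
  The \<open>\<complex>\<close>-algebra of functions generated by the \<open>n * p\<^sup>2\<close> coordinate functions. As \<open>\<complex>\<close> is infinite,
  polynomials and polynomial functions may be identified. (The library's \<open>polynomial_function\<close>
  means polynomial over \<open>\<real>\<close>, which would admit complex conjugation.)
\<close>

inductive_set poly_funs :: "(('n::finite, 'p::finite) mat_tuple \<Rightarrow> complex) set" where
  const: "(\<lambda>A. c) \<in> poly_funs"
| coord: "(\<lambda>A. A $ k $ i $ j) \<in> poly_funs"
| add: "f \<in> poly_funs \<Longrightarrow> h \<in> poly_funs \<Longrightarrow> (\<lambda>A. f A + h A) \<in> poly_funs"
| mult: "f \<in> poly_funs \<Longrightarrow> h \<in> poly_funs \<Longrightarrow> (\<lambda>A. f A * h A) \<in> poly_funs"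

definition invariants :: "(('n::finite, 'p::finite) mat_tuple \<Rightarrow> complex) set" where
  "invariants = {f \<in> poly_funs. \<forall>g\<in>GL. \<forall>A. f (sim_conj g A) = f A}"

definition separating_set :: "(('n::finite, 'p::finite) mat_tuple \<Rightarrow> complex) set \<Rightarrow> bool" where
  "separating_set S \<longleftrightarrow> S \<subseteq> invariants \<and>
     (\<forall>v w. (\<forall>s\<in>S. s v = s w) \<longleftrightarrow> (\<forall>f\<in>invariants. f v = f w))"

end

theory Submission
  imports Defs "HOL-Library.Function_Algebras" "HOL-Computational_Algebra.Fundamental_Theorem_Algebra"
begin

text \<open>
  If \<open>S\<close> is separating, the functions \<open>s(v) - s(w)\<close> for \<open>s \<in> S\<close> cut out the separating variety in
  the space of pairs of tuples. Besides the closure of the set of pairs of conjugate tuples, it has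
  components of codimension \<open>(n - 1) p\<^sup>2 + p\<close>, consisting of pairs of triangularizable tuples with
  the same diagonal characters but incompatible extensions between them. Restricting to an affine
  slice of that dimension through such a component, one is left with \<open>|S|\<close> polynomials
  in \<open>(n - 1) p\<^sup>2 + p\<close> variables having an isolated common zero, and the number of polynomials is then at
  least the number of variables. For \<open>n \<ge> 3\<close> both tuples are triangular in the same order and the
  incompatibility comes from linearly independent superdiagonal vectors; for \<open>n = 2\<close> two different orders
  of the characters are used, which requires \<open>p \<ge> 4\<close>.
\<close>

section \<open>Polynomial functions and the Nullstellensatz\<close>

text \<open>Since \<open>S\<close> is arbitrary, equality of all invariants has to be turned into
  equations between entries. For this one matrix is kept diagonal with distinct eigenvalues:
  polynomials in it produce the diagonal matrix units, and the traces of words with these units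
  inserted are products of entries along cycles of indices. A nonzero free entry below the diagonal
  would close a cycle that the other tuple lacks. With two further matrices, cycles of length two
  through different matrices show this. With a single further matrix the argument compares the
  directed graphs of nonzero entries, of which equal cycle products preserve the strong components.
  The slice also meets pairs with equal invariants away from the chosen point, so the equations must
  be counted locally. This is a form of Krull's height theorem, obtained here by comparing the
  growth of two spaces of jets.\<close>

lemmas fun_arith_apply = plus_fun_apply times_fun_apply zero_fun_apply one_fun_apply

text \<open>Evaluation at points is kept out of the simplifier, so that polynomials can be computed
  with as elements of a ring.\<close>

declare fun_arith_apply [simp del]

section \<open>Polynomial functions in the variables \<open>J\<close>, monomials and linear
  dependence\<close>

inductive_set polys :: "'i set \<Rightarrow> (('i \<Rightarrow> complex) \<Rightarrow> complex) set" for J where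
  const: "(\<lambda>x. c) \<in> polys J"
| var: "i \<in> J \<Longrightarrow> (\<lambda>x. x i) \<in> polys J"
| add: "f \<in> polys J \<Longrightarrow> g \<in> polys J \<Longrightarrow> f + g \<in> polys J"
| mult: "f \<in> polys J \<Longrightarrow> g \<in> polys J \<Longrightarrow> f * g \<in> polys J"

definition monom_fun :: "'i set \<Rightarrow> ('i \<Rightarrow> nat) \<Rightarrow> ('i \<Rightarrow> complex) \<Rightarrow> complex" where
  "monom_fun J \<alpha> = (\<lambda>x. \<Prod>i\<in>J. x i ^ \<alpha> i)"

definition fscale :: "complex \<Rightarrow> ('a \<Rightarrow> complex) \<Rightarrow> 'a \<Rightarrow> complex" where
  "fscale c f = (\<lambda>x. c * f x)"

lemma fscale_apply: "fscale c f x = c * f x"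
  by (simp add: fscale_def)

interpretation fs: vector_space fscale
  by unfold_locales (auto simp: fun_eq_iff fun_arith_apply fscale_apply algebra_simps)

lemma sum_fun_apply: "(\<Sum>a\<in>A. f a) x = (\<Sum>a\<in>A. f a x)" for f :: "'a \<Rightarrow> 'b \<Rightarrow> complex"
  by (induction A rule: infinite_finite_induct) (auto simp: fun_arith_apply)

lemma prod_fun_apply: "(\<Prod>a\<in>A. f a) x = (\<Prod>a\<in>A. f a x)" for f :: "'a \<Rightarrow> 'b \<Rightarrow> complex"
  by (induction A rule: infinite_finite_induct) (auto simp: fun_arith_apply)

lemma power_fun_apply: "(f ^ n) x = f x ^ n" for f :: "'b \<Rightarrow> complex"
  by (induction n) (auto simp: fun_arith_apply)

text \<open>A family rather than a set, because \<open>u\<close> may repeat values. A repetition is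
  itself a relation, with coefficients 1 and -1; an injective family is too large to be independent
  in the span of \<open>B\<close>.\<close>

lemma dependent_family:
  assumes "finite A" "finite B" "card B < card A" "\<And>a. a \<in> A \<Longrightarrow> u a \<in> fs.span B"
  obtains c a where "a \<in> A" "c a \<noteq> 0" "(\<Sum>a\<in>A. fscale (c a) (u a)) = 0"
proof (cases "inj_on u A")
  case True
  have "fs.dependent (u ` A)"
  proof (rule ccontr)
    assume "\<not> fs.dependent (u ` A)"
    then have "card (u ` A) \<le> card B"
      using fs.independent_span_bound[of B "u ` A"] assms by auto
    then show False using assms card_image[OF True] by simp
  qed
  then obtain c v where c: "v \<in> u ` A" "c v \<noteq> 0" "(\<Sum>v\<in>u ` A. fscale (c v) v) = 0"
    using fs.dependent_finite[of "u ` A"] assms(1) by auto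
  show ?thesis
    using c that[of "inv_into A u v" "c \<circ> u"]
    by (auto simp: sum.reindex[OF True] True)
next
  case False
  then obtain a b where ab: "a \<in> A" "b \<in> A" "a \<noteq> b" "u a = u b" by (auto simp: inj_on_def)
  let ?c = "\<lambda>z. if z = a then 1 else if z = b then -1 else 0 :: complex"
  have "(\<Sum>z\<in>A. fscale (?c z) (u z)) = (\<Sum>z\<in>{a,b}. fscale (?c z) (u z))"
    using ab assms(1) by (intro sum.mono_neutral_right) (auto simp: fun_eq_iff fun_arith_apply fscale_apply)
  also have "\<dots> = 0" using ab by (auto simp: fun_eq_iff fun_arith_apply fscale_apply)
  finally show ?thesis using that[of a ?c] ab by auto
qed

lemma polys_fscale: "f \<in> polys J \<Longrightarrow> fscale c f \<in> polys J"
proof -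
  assume "f \<in> polys J"
  then have "(\<lambda>_. c) * f \<in> polys J" by (intro polys.intros)
  then show ?thesis by (simp add: fscale_def times_fun_def)
qed

lemma polys_0: "0 \<in> polys J" and polys_1: "1 \<in> polys J"
  using polys.const[of 0 J] polys.const[of 1 J] by (simp_all add: zero_fun_def one_fun_def)

lemma polys_diff: "f \<in> polys J \<Longrightarrow> g \<in> polys J \<Longrightarrow> f - g \<in> polys J"
  using polys.add[of f J "fscale (-1) g"] polys_fscale[of g J "-1"]
  by (simp add: fscale_def fun_diff_def plus_fun_def)

lemma polys_sum: "(\<And>a. a \<in> A \<Longrightarrow> f a \<in> polys J) \<Longrightarrow> sum f A \<in> polys J"
  by (induction A rule: infinite_finite_induct) (auto intro: polys_0 polys.add)

lemma polys_prod: "(\<And>a. a \<in> A \<Longrightarrow> f a \<in> polys J) \<Longrightarrow> prod f A \<in> polys J"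
  by (induction A rule: infinite_finite_induct) (auto intro: polys_1 polys.mult)

lemma polys_power: "f \<in> polys J \<Longrightarrow> f ^ n \<in> polys J"
  by (induction n) (auto intro: polys_1 polys.mult)

lemma polys_poly: "f \<in> polys J \<Longrightarrow> (\<lambda>x. poly P (f x)) \<in> polys J"
proof (induction P)
  case 0
  then show ?case using polys.const[of 0] by simp
next
  case (pCons a P)
  then have "(\<lambda>_. a) + f * (\<lambda>x. poly P (f x)) \<in> polys J" by (intro polys.intros) auto
  then show ?case by (simp add: plus_fun_def times_fun_def)
qed

lemma monom_fun_polys: "monom_fun J \<alpha> \<in> polys J"
proof -
  have "monom_fun J \<alpha> = (\<Prod>i\<in>J. (\<lambda>x. x i) ^ \<alpha> i)"
    by (auto simp: monom_fun_def fun_eq_iff fun_arith_apply prod_fun_apply power_fun_apply)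
  then show ?thesis by (auto intro: polys_prod polys_power polys.var)
qed

lemma polys_subset_span_monom_fun:
  assumes "finite J" "f \<in> polys J"
  shows "f \<in> fs.span (range (monom_fun J))"
  using assms(2)
proof induction
  case (const c)
  have "(\<lambda>x. c) = fscale c (monom_fun J (\<lambda>_. 0))"
    by (auto simp: monom_fun_def fun_eq_iff fun_arith_apply fscale_apply)
  then show ?case by (auto intro: fs.span_scale fs.span_base)
next
  case (var i)
  have "x i = (\<Prod>j\<in>J. x j ^ (if j = i then 1 else 0))" for x :: "_ \<Rightarrow> complex"
    using var assms(1) by (subst prod.remove[of _ i]) auto
  then have "(\<lambda>x. x i) = monom_fun J (\<lambda>j. if j = i then 1 else 0)"
    by (auto simp: monom_fun_def fun_eq_iff fun_arith_apply)
  then show ?case by (auto intro: fs.span_base)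
next
  case (add f g)
  then show ?case by (intro fs.span_add)
next
  case (mult f g)
  let ?S = "fs.span (range (monom_fun J))"
  have 1: "monom_fun J \<alpha> * g \<in> ?S" if "g \<in> ?S" for \<alpha> g
    using that
  proof (induction rule: fs.span_induct_alt)
    case base
    show ?case by (simp only: mult_zero_left mult_zero_right fs.span_zero)
  next
    case (step c g h)
    then obtain \<beta> where "g = monom_fun J \<beta>" by auto
    then have "monom_fun J \<alpha> * (fscale c g + h) =
        fscale c (monom_fun J (\<lambda>i. \<alpha> i + \<beta> i)) + monom_fun J \<alpha> * h"
      by (auto simp: monom_fun_def fun_eq_iff fun_arith_apply fscale_apply power_add prod.distrib algebra_simps)
    moreover have "\<dots> \<in> ?S" by (rule fs.span_add, rule fs.span_scale, rule fs.span_base, rule rangeI, rule step)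
    ultimately show ?case by (simp only:)
  qed
  from mult(3) show ?case
  proof (induction rule: fs.span_induct_alt)
    case base
    show ?case by (simp only: mult_zero_left mult_zero_right fs.span_zero)
  next
    case (step c f h)
    then obtain \<alpha> where "f = monom_fun J \<alpha>" by auto
    then have "(fscale c f + h) * g = fscale c (monom_fun J \<alpha> * g) + h * g"
      by (auto simp: fun_eq_iff fun_arith_apply fscale_apply algebra_simps)
    moreover have "\<dots> \<in> ?S" using step 1[OF mult(4)] by (intro fs.span_add fs.span_scale)
    ultimately show ?case by (simp only:)
  qed
qed

text \<open>Bounding the exponents exhausts the polynomials by countably many finite-dimensional
  spaces, as the pigeonhole argument in \<open>adjoin_point\<close> requires.\<close>

lemma polys_finite_span:
  assumes "finite J" "f \<in> polys J"
  shows "\<exists>n. f \<in> fs.span (monom_fun J ` (PiE J (\<lambda>_. {..n})))"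
proof -
  obtain B where B: "finite B" "B \<subseteq> range (monom_fun J)" "f \<in> fs.span B"
    using polys_subset_span_monom_fun[OF assms] fs.span_explicit[of "range (monom_fun J)"]
    by (auto, metis (no_types, lifting) fs.span_base fs.span_scale fs.span_sum)
  then obtain C where C: "finite C" "B = monom_fun J ` C" by (meson finite_subset_image)
  define n where "n = Max (insert 0 ((\<lambda>(\<alpha>, i). \<alpha> i) ` (C \<times> J)))"
  have "B \<subseteq> monom_fun J ` (PiE J (\<lambda>_. {..n}))"
  proof
    fix b assume "b \<in> B"
    then obtain \<alpha> where \<alpha>: "\<alpha> \<in> C" "b = monom_fun J \<alpha>" using C by auto
    have "\<alpha> i \<le> n" if "i \<in> J" for i
      unfolding n_def using that \<alpha> C assms by (intro Max_ge) (auto intro!: image_eqI[of _ _ "(\<alpha>, i)"])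
    moreover have "b = monom_fun J (restrict \<alpha> J)"
      using \<alpha> by (auto simp: monom_fun_def fun_eq_iff fun_arith_apply)
    ultimately show "b \<in> monom_fun J ` (PiE J (\<lambda>_. {..n}))"
      by (auto intro!: image_eqI[of _ _ "restrict \<alpha> J"])
  qed
  then show ?thesis using B fs.span_mono by blast
qed

section \<open>Ideals of polynomial functions and the Nullstellensatz\<close>

definition poly_ideal :: "'i set \<Rightarrow> (('i \<Rightarrow> complex) \<Rightarrow> complex) set \<Rightarrow> bool" where
  "poly_ideal J I \<longleftrightarrow> I \<subseteq> polys J \<and> 0 \<in> I \<and> (\<forall>f\<in>I. \<forall>g\<in>I. f + g \<in> I) \<and> (\<forall>q\<in>polys J. \<forall>f\<in>I. q * f \<in> I)"

lemma poly_idealD: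
  assumes "poly_ideal J I"
  shows "f \<in> I \<Longrightarrow> f \<in> polys J" "0 \<in> I" "f \<in> I \<Longrightarrow> g \<in> I \<Longrightarrow> f + g \<in> I"
    "q \<in> polys J \<Longrightarrow> f \<in> I \<Longrightarrow> q * f \<in> I"
  using assms by (auto simp: poly_ideal_def)

lemma poly_ideal_diff:
  assumes "poly_ideal J I" "f \<in> I" "g \<in> I"
  shows "f - g \<in> I"
proof -
  have "(\<lambda>_. - 1) * g \<in> I" by (rule poly_idealD(4)[OF assms(1) polys.const assms(3)])
  then have "f + (\<lambda>_. - 1) * g \<in> I" by (rule poly_idealD(3)[OF assms(1,2)])
  then show ?thesis by (simp add: fun_diff_def plus_fun_def times_fun_def)
qed

lemma poly_ideal_sum:
  assumes "poly_ideal J I" "\<And>a. a \<in> A \<Longrightarrow> f a \<in> I"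
  shows "sum f A \<in> I"
  using assms(2) by (induction A rule: infinite_finite_induct) (auto intro: poly_idealD[OF assms(1)])

definition adjoin :: "'i set \<Rightarrow> (('i \<Rightarrow> complex) \<Rightarrow> complex) \<Rightarrow> (('i \<Rightarrow> complex) \<Rightarrow> complex) set \<Rightarrow> (('i \<Rightarrow> complex) \<Rightarrow> complex) set" where
  "adjoin J g I = {f + q * g |f q. f \<in> I \<and> q \<in> polys J}"

lemma adjoinI: "f \<in> I \<Longrightarrow> q \<in> polys J \<Longrightarrow> f + q * g \<in> adjoin J g I"
  by (auto simp: adjoin_def)

lemma adjoinE:
  assumes "h \<in> adjoin J g I"
  obtains f q where "h = f + q * g" "f \<in> I" "q \<in> polys J"
  using assms by (auto simp: adjoin_def)

lemma poly_ideal_adjoin: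
  assumes I: "poly_ideal J I" and g: "g \<in> polys J"
  shows "poly_ideal J (adjoin J g I)" "I \<subseteq> adjoin J g I" "g \<in> adjoin J g I"
proof -
  have "f \<in> adjoin J g I" if "f \<in> I" for f
    using adjoinI[OF that polys_0[of J], of g] by simp
  then show "I \<subseteq> adjoin J g I" by auto
  then have 0: "0 \<in> adjoin J g I" using poly_idealD(2)[OF I] by auto
  show "g \<in> adjoin J g I"
    using adjoinI[OF poly_idealD(2)[OF I] polys_1[of J], of g] by simp
  have 1: "f + h \<in> adjoin J g I" if fh: "f \<in> adjoin J g I" "h \<in> adjoin J g I" for f h
  proof -
    obtain a q b r where "f = a + q * g" "h = b + r * g" "a \<in> I" "b \<in> I" "q \<in> polys J" "r \<in> polys J"
      using fh by (elim adjoinE)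
    moreover then have "f + h = (a + b) + (q + r) * g" by (simp add: algebra_simps)
    ultimately show ?thesis
      using poly_idealD(3)[OF I] polys.add adjoinI by metis
  qed
  have 2: "s * f \<in> adjoin J g I" if fh: "f \<in> adjoin J g I" "s \<in> polys J" for f s
  proof -
    obtain a q where "f = a + q * g" "a \<in> I" "q \<in> polys J"
      using fh by (elim adjoinE)
    moreover then have "s * f = s * a + (s * q) * g" by (simp add: algebra_simps)
    ultimately show ?thesis
      using poly_idealD(4)[OF I] polys.mult fh(2) adjoinI by metis
  qed
  show "poly_ideal J (adjoin J g I)"
    unfolding poly_ideal_def using 0 1 2 g
    by (auto simp: adjoin_def intro!: polys.intros dest: poly_idealD(1)[OF I])
qed

text \<open>Over the complex numbers \<open>P\<close> splits into linear factors. A product of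
  elements of I + (a) and I + (b) lies in I + (ab), so the memberships for the factors multiply and
  the exponents of \<open>h\<close> add up.\<close>

lemma ideal_power_step:
  assumes I: "poly_ideal J I" and h: "h \<in> polys J" and g: "g \<in> polys J"
    and inv: "\<And>b. \<exists>r. h ^ r \<in> adjoin J (\<lambda>x. g x - b) I" and "P \<noteq> 0"
  shows "\<exists>r. h ^ r \<in> adjoin J (\<lambda>x. poly P (g x)) I"
  using \<open>P \<noteq> 0\<close>
proof (induction "degree P" arbitrary: P)
  case 0
  then obtain c where c: "P = [:c:]" "c \<noteq> 0" by (metis degree_eq_zeroE pCons_0_0)
  have "h ^ 0 = 0 + (\<lambda>_. 1 / c) * (\<lambda>x. poly P (g x))" using c by (auto simp: fun_eq_iff fun_arith_apply)
  then show ?case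
    using adjoinI[OF poly_idealD(2)[OF I] polys.const[of "1/c" J]] by metis
next
  case (Suc n)
  have "\<not> constant (poly P)" using Suc(2) by (simp add: constant_degree)
  then obtain b where b: "poly P b = 0" using fundamental_theorem_of_algebra by blast
  then obtain Q where Q: "P = [:-b, 1:] * Q" by (metis dvdE poly_eq_0_iff_dvd)
  have "Q \<noteq> 0" using Suc Q by auto
  then have "degree P = Suc (degree Q)" unfolding Q by (subst degree_mult_eq) auto
  then obtain r where "h ^ r \<in> adjoin J (\<lambda>x. poly Q (g x)) I" using Suc \<open>Q \<noteq> 0\<close> by auto
  then obtain f q where f: "h ^ r = f + q * (\<lambda>x. poly Q (g x))" "f \<in> I" "q \<in> polys J"
    by (elim adjoinE)
  from inv[of b] obtain s f' q' where f': "h ^ s = f' + q' * (\<lambda>x. g x - b)" "f' \<in> I" "q' \<in> polys J"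
    by (elim exE adjoinE)
  have "h ^ (s + r) = h ^ s * f + (q * (\<lambda>x. poly Q (g x)) * f' + (q' * q) * (\<lambda>x. poly P (g x)))"
    unfolding power_add f(1)
    apply (subst distrib_left, rule arg_cong2[where f="(+)"], rule refl)
    unfolding f'(1) Q by (auto simp: fun_eq_iff fun_arith_apply algebra_simps)
  moreover have "h ^ s * f + q * (\<lambda>x. poly Q (g x)) * f' \<in> I"
    by (intro poly_idealD(3,4)[OF I] polys_power polys.mult polys_poly g h f(2,3) f'(2,3))
  moreover have "q' * q \<in> polys J" using f f' by (auto intro: polys.mult)
  ultimately show ?case by (metis (no_types, lifting) add.assoc adjoinI)
qed

text \<open>
  Otherwise every \<open>x\<^sub>i - a\<close> is invertible modulo \<open>I\<close> up to powers of \<open>h\<close>. These uncountably many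
  inverses lie in a space of countable dimension, so some of them are linearly dependent, which puts
  the product of a power of \<open>h\<close> and a nonzero polynomial in \<open>x\<^sub>i\<close> into \<open>I\<close>.
\<close>

lemma adjoin_point:
  assumes J: "finite J" and I: "poly_ideal J I" and h: "h \<in> polys J" and i: "i \<in> J"
    and pow: "\<And>r. h ^ r \<notin> I"
  shows "\<exists>a. \<forall>r. h ^ r \<notin> adjoin J (\<lambda>x. x i - a) I"
proof (rule ccontr)
  assume "\<not> ?thesis"
  then have inv: "\<exists>r. h ^ r \<in> adjoin J (\<lambda>x. x i - a) I" for a by blast
  then have "\<exists>q r n. h ^ r - q * (\<lambda>x. x i - a) \<in> I \<and> q \<in> polys J
      \<and> q \<in> fs.span (monom_fun J ` (PiE J (\<lambda>_. {..n})))" for a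
  proof -
    obtain r f q where f: "h ^ r = f + q * (\<lambda>x. x i - a)" "f \<in> I" "q \<in> polys J"
      using inv[of a] by (elim exE adjoinE)
    then have "h ^ r - q * (\<lambda>x. x i - a) \<in> I" by simp
    then show ?thesis using f(3) polys_finite_span[OF J f(3)] by blast
  qed
  then obtain q r n where q: "\<And>a. h ^ (r a) - q a * (\<lambda>x. x i - a) \<in> I" "\<And>a. q a \<in> polys J"
      "\<And>a. q a \<in> fs.span (monom_fun J ` (PiE J (\<lambda>_. {..n a})))" by metis
  \<comment> \<open>There are only countably many pairs of an exponent and a degree bound, but
    uncountably many points. The exponent must be common too, so that the relations below all
    involve the same power of \<open>h\<close>.\<close>
  have "\<exists>s m. infinite {a. r a = s \<and> n a = m}"
  proof (rule ccontr)
    assume "\<not> ?thesis"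
    then have "countable (\<Union>s. \<Union>m. {a. r a = s \<and> n a = m})" by (intro countable_UN) (auto intro: countable_finite)
    moreover have "(\<Union>s. \<Union>m. {a. r a = s \<and> n a = m}) = UNIV" by auto
    ultimately show False using uncountable_UNIV_complex by simp
  qed
  then obtain s m where sm: "infinite {a. r a = s \<and> n a = m}" by blast
  define B where "B = monom_fun J ` (PiE J (\<lambda>_. {..m}))"
  have B: "finite B" unfolding B_def using J by (auto intro: finite_PiE)
  obtain A where A: "A \<subseteq> {a. r a = s \<and> n a = m}" "finite A" "card A = Suc (card B)"
    using infinite_arbitrarily_large[OF sm] by blast
  have "\<And>a. a \<in> A \<Longrightarrow> q a \<in> fs.span B" using A(1) q(3) unfolding B_def by blast
  then obtain c a0 where c: "a0 \<in> A" "c a0 \<noteq> 0" "(\<Sum>a\<in>A. fscale (c a) (q a)) = 0"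
    using dependent_family[of A B q] A B by (metis lessI)
  \<comment> \<open>The numerator of the sum of c(a) / (X - a) over \<open>A\<close>. At
    \<open>a0\<close> only the summand with a = a0 survives, so \<open>P\<close> is not
    zero.\<close>
  define P where "P = (\<Sum>a\<in>A. smult (c a) (\<Prod>l\<in>A-{a}. [:-l, 1:]))"
  have "poly P a0 = (\<Sum>a\<in>A. if a = a0 then c a0 * (\<Prod>l\<in>A-{a0}. a0 - l) else 0)"
    unfolding P_def poly_sum poly_smult poly_prod
  proof (intro sum.cong refl)
    fix a assume "a \<in> A"
    show "c a * (\<Prod>l\<in>A-{a}. poly [:-l, 1:] a0) = (if a = a0 then c a0 * (\<Prod>l\<in>A-{a0}. a0 - l) else 0)"
      using c(1) A(2) by (cases "a = a0") (auto intro!: prod_zero bexI[of _ a0])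
  qed
  then have "poly P a0 \<noteq> 0" using A c by simp
  then have "P \<noteq> 0" by auto
  then obtain t f g where t: "h ^ t = f + g * (\<lambda>x. poly P (x i))" "f \<in> I" "g \<in> polys J"
    using ideal_power_step[OF I h polys.var[OF i] inv] by (metis adjoinE)
  define R where "R a = (\<lambda>x::_ \<Rightarrow> complex. c a * (\<Prod>l\<in>A-{a}. x i - l))" for a
  have R: "R a \<in> polys J" for a
    using polys_poly[OF polys.var[OF i], of "smult (c a) (\<Prod>l\<in>A-{a}. [:-l, 1:])"]
    by (simp add: R_def poly_prod)
  \<comment> \<open>Multiplying \<open>R a\<close> by x_i - a gives c(a) times a product independent
    of \<open>a\<close>. The terms with \<open>q a\<close> therefore cancel by the linear relation,
    and the power of \<open>h\<close> times P(x_i) remains.\<close>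
  have "(\<Sum>a\<in>A. R a * (h ^ s - q a * (\<lambda>x. x i - a))) \<in> I"
    using A q(1) by (auto intro!: poly_ideal_sum[OF I] poly_idealD(4)[OF I] R)
  also have "(\<Sum>a\<in>A. R a * (h ^ s - q a * (\<lambda>x. x i - a))) = h ^ s * (\<lambda>x. poly P (x i))"
  proof
    fix x :: "_ \<Rightarrow> complex"
    have "(\<Sum>a\<in>A. R a x * q a x * (x i - a)) = (\<Sum>a\<in>A. (c a * q a x) * (\<Prod>l\<in>A. x i - l))"
      using A(2) by (intro sum.cong) (auto simp: R_def prod.remove)
    also have "\<dots> = (\<Sum>a\<in>A. fscale (c a) (q a)) x * (\<Prod>l\<in>A. x i - l)"
      by (simp add: sum_distrib_right sum_fun_apply fscale_apply)
    finally have "(\<Sum>a\<in>A. R a x * q a x * (x i - a)) = 0" using c by (simp add: fun_arith_apply)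
    moreover have "(\<Sum>a\<in>A. R a * (h ^ s - q a * (\<lambda>x. x i - a))) x
        = (\<Sum>a\<in>A. R a x * h x ^ s - R a x * q a x * (x i - a))"
      unfolding sum_fun_apply
      by (intro sum.cong refl) (simp add: power_fun_apply fun_arith_apply algebra_simps)
    moreover have "(\<Sum>a\<in>A. R a x) = poly P (x i)"
      by (simp add: R_def P_def poly_sum poly_prod)
    ultimately show "(\<Sum>a\<in>A. R a * (h ^ s - q a * (\<lambda>x. x i - a))) x = (h ^ s * (\<lambda>x. poly P (x i))) x"
      by (simp add: sum_subtractf power_fun_apply fun_arith_apply mult.commute flip: sum_distrib_right)
  qed
  finally have 1: "h ^ s * (\<lambda>x. poly P (x i)) \<in> I" .
  have "h ^ (s + t) = h ^ s * f + g * (h ^ s * (\<lambda>x. poly P (x i)))"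
    unfolding power_add t(1) by (simp add: algebra_simps)
  also have "\<dots> \<in> I" using 1 t h by (auto intro!: poly_idealD(3,4)[OF I] polys_power)
  finally show False using pow by blast
qed

text \<open>If no power of \<open>h\<close> lies in \<open>I\<close>, the coordinates can be fixed
  one at a time by \<open>adjoin_point\<close>, which ends at a zero of \<open>I\<close> where
  \<open>h\<close> does not vanish. Keeping all powers of \<open>h\<close> out plays the part of
  Rabinowitsch's extra variable.\<close>

lemma nullstellensatz:
  assumes J: "finite J" and I: "poly_ideal J I" and h: "h \<in> polys J"
    and zero: "\<And>x. (\<And>f. f \<in> I \<Longrightarrow> f x = 0) \<Longrightarrow> h x = 0"
  shows "\<exists>r. h ^ r \<in> I"
proof (rule ccontr)
  assume neg: "\<not> ?thesis"
  have "\<exists>a I'. poly_ideal J I' \<and> I \<subseteq> I' \<and> (\<forall>i\<in>K. (\<lambda>x. x i - a i) \<in> I') \<and> (\<forall>r. h ^ r \<notin> I')"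
    if "K \<subseteq> J" for K
    using finite_subset[OF that J] that
  proof (induction K rule: finite_induct)
    case empty
    then show ?case using I neg by auto
  next
    case (insert i K)
    then obtain a I' where I': "poly_ideal J I'" "I \<subseteq> I'" "\<forall>i\<in>K. (\<lambda>x. x i - a i) \<in> I'" "\<forall>r. h ^ r \<notin> I'"
      by auto
    then obtain b where b: "\<forall>r. h ^ r \<notin> adjoin J (\<lambda>x. x i - b) I'"
      using adjoin_point[OF J I'(1) h, of i] insert by auto
    have "(\<lambda>x. x i - b) \<in> polys J"
      using polys_diff[OF polys.var polys.const, of i J b] insert by (simp add: fun_diff_def)
    note * = poly_ideal_adjoin[OF I'(1) this]
    have "\<forall>j\<in>insert i K. (\<lambda>x. x j - (a(i := b)) j) \<in> adjoin J (\<lambda>x. x i - b) I'"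
      using *(2,3) I' insert(2) by auto
    then show ?case using b * I' by (intro exI[of _ "a(i := b)"] exI[of _ "adjoin J (\<lambda>x. x i - b) I'"]) auto
  qed
  from this[of J] obtain a I' where I': "poly_ideal J I'" "I \<subseteq> I'"
      "\<And>i. i \<in> J \<Longrightarrow> (\<lambda>x. x i - a i) \<in> I'" "\<And>r. h ^ r \<notin> I'" by auto
  \<comment> \<open>Modulo \<open>I'\<close> every polynomial is the constant given by its value at
    \<open>a\<close>. Hence a nonzero value of an element of \<open>I\<close> would put 1, the
    zeroth power of \<open>h\<close>, into \<open>I'\<close>.\<close>
  have eval: "f - (\<lambda>_. f a) \<in> I'" if "f \<in> polys J" for f
    using that
  proof induction
    case (const c)
    then show ?case using poly_idealD(2)[OF I'(1)] by (simp add: fun_diff_def zero_fun_def)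
  next
    case (var i)
    then show ?case using I'(3) by (simp add: fun_diff_def)
  next
    case (add f g)
    have "(f + g) - (\<lambda>_. (f + g) a) = (f - (\<lambda>_. f a)) + (g - (\<lambda>_. g a))" by (auto simp: fun_eq_iff fun_arith_apply)
    then show ?case using poly_idealD(3)[OF I'(1) add(3,4)] by metis
  next
    case (mult f g)
    have "(f * g) - (\<lambda>_. (f * g) a) = g * (f - (\<lambda>_. f a)) + (\<lambda>_. f a) * (g - (\<lambda>_. g a))"
      by (auto simp: fun_eq_iff fun_arith_apply algebra_simps)
    moreover have "\<dots> \<in> I'" using mult by (intro poly_idealD(3,4)[OF I'(1)] polys.const)
    ultimately show ?case by metis
  qed
  have "f a = 0" if "f \<in> I" for f
  proof (rule ccontr)
    assume "f a \<noteq> 0"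
    have fI: "f \<in> I'" using that I' by auto
    then have "f - (f - (\<lambda>_. f a)) \<in> I'"
      using poly_ideal_diff[OF I'(1)] eval poly_idealD(1)[OF I'(1)] by blast
    then have "(\<lambda>_. 1 / f a) * (f - (f - (\<lambda>_. f a))) \<in> I'" by (intro poly_idealD(4)[OF I'(1)] polys.const)
    moreover have "(\<lambda>_. 1 / f a) * (f - (f - (\<lambda>_. f a))) = h ^ 0" using \<open>f a \<noteq> 0\<close> by (auto simp: fun_eq_iff fun_arith_apply)
    ultimately show False using I'(4)[of 0] by simp
  qed
  then have "h a = 0" using zero by blast
  then have "h ^ 1 \<in> I'" using eval[OF h] by (simp add: fun_diff_def)
  then show False using I'(4) by blast
qed

section \<open>The number of equations of an isolated zero\<close>

lemma polynomial_zero_coeffs: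
  fixes C :: "nat \<Rightarrow> complex"
  assumes "\<And>z. (\<Sum>n<K. C n * z ^ n) = 0" "n < K"
  shows "C n = 0"
proof -
  have "poly (\<Sum>n<K. monom (C n) n) z = poly 0 z" for z
    using assms(1)[of z] by (simp add: poly_sum poly_monom)
  then have "(\<Sum>n<K. monom (C n) n) = 0" by (simp add: poly_eq_poly_eq_iff[symmetric] fun_eq_iff)
  then have "coeff (\<Sum>n<K. monom (C n) n) n = 0" by simp
  then show ?thesis using assms(2) by (simp add: coeff_sum sum.delta')
qed

lemma monom_fun_independent:
  assumes "finite J" "\<And>x. (\<Sum>\<alpha>\<in>PiE J (\<lambda>_. {..<K}). c \<alpha> * monom_fun J \<alpha> x) = 0"
    and "\<alpha> \<in> PiE J (\<lambda>_. {..<K})"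
  shows "c \<alpha> = 0"
  using assms
proof (induction J arbitrary: c \<alpha> rule: finite_induct)
  case empty
  then show ?case by (simp add: monom_fun_def)
next
  case (insert i J)
  have "(\<Sum>\<beta>\<in>PiE J (\<lambda>_. {..<K}). c (\<beta>(i := n)) * monom_fun J \<beta> x) = 0" if "n < K" for n x
  proof (rule polynomial_zero_coeffs[OF _ that])
    fix z
    have 1: "monom_fun (insert i J) (\<beta>(i := n)) (x(i := z)) = z ^ n * monom_fun J \<beta> x" for \<beta> n
    proof -
      have "(\<Prod>j\<in>J. (x(i := z)) j ^ (\<beta>(i := n)) j) = (\<Prod>j\<in>J. x j ^ \<beta> j)"
        using insert(2) by (intro prod.cong) auto
      then show ?thesis using insert(1,2) by (simp add: monom_fun_def)
    qed
    have "0 = (\<Sum>\<alpha>\<in>PiE (insert i J) (\<lambda>_. {..<K}). c \<alpha> * monom_fun (insert i J) \<alpha> (x(i := z)))"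
      using insert.prems(1) by simp
    also have "\<dots> = (\<Sum>(n, \<beta>)\<in>{..<K} \<times> PiE J (\<lambda>_. {..<K}). c (\<beta>(i := n)) * (z ^ n * monom_fun J \<beta> x))"
      unfolding PiE_insert_eq using insert(2)
      by (subst sum.reindex[OF inj_combinator]) (auto simp: 1 intro!: sum.cong)
    also have "\<dots> = (\<Sum>n<K. (\<Sum>\<beta>\<in>PiE J (\<lambda>_. {..<K}). c (\<beta>(i := n)) * monom_fun J \<beta> x) * z ^ n)"
      by (simp add: sum.cartesian_product[symmetric] sum_distrib_left mult_ac)
    finally show "(\<Sum>n<K. (\<Sum>\<beta>\<in>PiE J (\<lambda>_. {..<K}). c (\<beta>(i := n)) * monom_fun J \<beta> x) * z ^ n) = 0" by simp
  qed
  moreover obtain n \<beta> where "n < K" "\<beta> \<in> PiE J (\<lambda>_. {..<K})" "\<alpha> = \<beta>(i := n)"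
    using insert.prems(2) unfolding PiE_insert_eq by auto
  ultimately show ?case using insert.IH[of "\<lambda>\<beta>. c (\<beta>(i := n))" \<beta>] by metis
qed

text \<open>For polynomials this is the k-th power of the maximal ideal at the origin. Testing it on
  lines through the origin reduces it to divisibility by t^k in one variable.\<close>

definition ord_ge :: "nat \<Rightarrow> (('i \<Rightarrow> complex) \<Rightarrow> complex) set" where
  "ord_ge k = {p. \<forall>x. \<exists>q. \<forall>t. p (\<lambda>i. t * x i) = t ^ k * poly q t}"

lemma ord_ge_mult:
  assumes "f \<in> ord_ge k" "g \<in> ord_ge l"
  shows "f * g \<in> ord_ge (k + l)"
  unfolding ord_ge_def
proof safe
  fix x
  obtain q1 q2 where "\<forall>t. f (\<lambda>i. t * x i) = t ^ k * poly q1 t" "\<forall>t. g (\<lambda>i. t * x i) = t ^ l * poly q2 t"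
    using assms unfolding ord_ge_def by blast
  then show "\<exists>q. \<forall>t. (f * g) (\<lambda>i. t * x i) = t ^ (k + l) * poly q t"
    by (intro exI[of _ "q1 * q2"]) (auto simp: power_add fun_arith_apply algebra_simps)
qed

lemma ord_ge_mono:
  assumes "f \<in> ord_ge l" "k \<le> l"
  shows "f \<in> ord_ge k"
  unfolding ord_ge_def
proof safe
  fix x
  obtain q where "\<forall>t. f (\<lambda>i. t * x i) = t ^ l * poly q t"
    using assms unfolding ord_ge_def by blast
  then show "\<exists>q. \<forall>t. f (\<lambda>i. t * x i) = t ^ k * poly q t"
    using assms(2) by (intro exI[of _ "monom 1 (l - k) * q"]) (auto simp: poly_monom simp flip: power_add)
qed

lemma ord_ge_add:
  assumes "f \<in> ord_ge k" "g \<in> ord_ge k"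
  shows "f + g \<in> ord_ge k"
  unfolding ord_ge_def
proof safe
  fix x
  obtain q1 q2 where "\<forall>t. f (\<lambda>i. t * x i) = t ^ k * poly q1 t" "\<forall>t. g (\<lambda>i. t * x i) = t ^ k * poly q2 t"
    using assms unfolding ord_ge_def by blast
  then show "\<exists>q. \<forall>t. (f + g) (\<lambda>i. t * x i) = t ^ k * poly q t"
    by (intro exI[of _ "q1 + q2"]) (auto simp: fun_arith_apply algebra_simps)
qed

lemma subspace_ord_ge: "fs.subspace (ord_ge k)"
proof (rule fs.subspaceI)
  show "0 \<in> ord_ge k" unfolding ord_ge_def by (auto simp: fun_arith_apply intro!: exI[of _ 0])
next
  fix f g :: "('a \<Rightarrow> complex) \<Rightarrow> complex" and c
  assume "f \<in> ord_ge k"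
  then show "fscale c f \<in> ord_ge k"
    unfolding ord_ge_def fscale_apply by safe (metis mult.left_commute poly_smult)
qed (rule ord_ge_add)

lemma polys_ord_ge_0: "f \<in> polys J \<Longrightarrow> f \<in> ord_ge 0"
proof (induction rule: polys.induct)
  case (const c)
  then show ?case unfolding ord_ge_def by (auto intro!: exI[of _ "[:c:]"])
next
  case (var i)
  have "\<exists>q. \<forall>t. t * x i = poly q t" for x :: "_ \<Rightarrow> complex"
    by (intro exI[of _ "[:0, x i:]"]) auto
  then show ?case unfolding ord_ge_def by auto
next
  case (add f g)
  then show ?case by (intro ord_ge_add)
next
  case (mult f g)
  then show ?case using ord_ge_mult[of f 0 g 0] by simp
qed

lemma polys_ord_ge_1:
  assumes "f \<in> polys J" "f (\<lambda>_. 0) = 0"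
  shows "f \<in> ord_ge 1"
  unfolding ord_ge_def
proof safe
  fix x
  obtain q where q: "\<And>t. f (\<lambda>i. t * x i) = poly q t"
    using polys_ord_ge_0[OF assms(1)] unfolding ord_ge_def by fastforce
  then have "poly q 0 = 0" using assms(2) q[of 0] by simp
  then obtain q' where "q = [:0, 1:] * q'" by (metis dvdE minus_zero poly_eq_0_iff_dvd)
  then show "\<exists>q. \<forall>t. f (\<lambda>i. t * x i) = t ^ 1 * poly q t"
    using q by (intro exI[of _ q']) auto
qed

lemma ord_ge_power: "f \<in> ord_ge k \<Longrightarrow> f ^ n \<in> ord_ge (k * n)"
proof (induction n)
  case 0
  then show ?case using polys_ord_ge_0[OF polys_1] by simp
next
  case (Suc n)
  then show ?case using ord_ge_mult[of f k "f ^ n" "k * n"] by simp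
qed

lemma ord_ge_prod: "(\<And>a. a \<in> A \<Longrightarrow> f a \<in> ord_ge (k a)) \<Longrightarrow> prod f A \<in> ord_ge (sum k A)"
proof (induction A rule: infinite_finite_induct)
  case (insert a A)
  then show ?case using ord_ge_mult[of "f a" "k a" "prod f A" "sum k A"] by simp
qed (auto intro: polys_ord_ge_0 polys_1)

text \<open>On the line through \<open>x\<close> the combination is a polynomial in \<open>t\<close>
  of degree below \<open>k\<close> (or zero) that is divisible by t^k. It is therefore zero, and t =
  1 gives the claim.\<close>

lemma monom_fun_ord_ge_zero:
  assumes J: "finite J" and A: "finite A" "\<And>\<alpha>. \<alpha> \<in> A \<Longrightarrow> sum \<alpha> J < k"
    and ord: "(\<Sum>\<alpha>\<in>A. fscale (c \<alpha>) (monom_fun J \<alpha>)) \<in> ord_ge k"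
  shows "(\<Sum>\<alpha>\<in>A. c \<alpha> * monom_fun J \<alpha> x) = 0"
proof -
  obtain q where q: "\<And>t. (\<Sum>\<alpha>\<in>A. fscale (c \<alpha>) (monom_fun J \<alpha>)) (\<lambda>i. t * x i) = t ^ k * poly q t"
    using ord unfolding ord_ge_def by blast
  define L where "L = (\<Sum>\<alpha>\<in>A. monom (c \<alpha> * monom_fun J \<alpha> x) (sum \<alpha> J))"
  have L: "poly L t = (\<Sum>\<alpha>\<in>A. fscale (c \<alpha>) (monom_fun J \<alpha>)) (\<lambda>i. t * x i)" for t
    unfolding L_def
    by (simp add: poly_sum poly_monom sum_fun_apply fscale_apply monom_fun_def power_mult_distrib
        prod.distrib power_sum mult_ac)
  then have "poly L t = poly (monom 1 k * q) t" for t using q by (simp add: poly_monom)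
  then have eq: "L = monom 1 k * q" by (simp add: poly_eq_poly_eq_iff[symmetric] fun_eq_iff)
  have "L = 0"
  proof (rule ccontr)
    assume "L \<noteq> 0"
    then have "degree L \<ge> k" unfolding eq by (subst degree_mult_eq) (auto simp: degree_monom_eq)
    moreover have "coeff L n = 0" if "n \<ge> k" for n
      unfolding L_def coeff_sum using A(2) that by (intro sum.neutral) fastforce
    ultimately show False using \<open>L \<noteq> 0\<close> leading_coeff_0_iff by blast
  qed
  then have "poly L 1 = 0" by simp
  then show ?thesis unfolding L_def by (simp add: poly_sum poly_monom)
qed

text \<open>
  By the Nullstellensatz, powers of the coordinates lie in the ideal of \<open>F\<close> up to terms of arbitrarily
  high order at the origin. Hence the \<open>k\<close>-jets are spanned by about \<open>k ^ card F\<close> products of elements of \<open>F\<close> and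
  fixed polynomials, while there are about \<open>k ^ card J\<close> independent jets.
\<close>

lemma card_le_card_isolated_zero:
  assumes J: "finite J" and F: "finite F" "F \<subseteq> polys J" "\<And>f. f \<in> F \<Longrightarrow> f (\<lambda>_. 0) = 0"
    and h: "h \<in> polys J" "h (\<lambda>_. 0) \<noteq> 0"
    and zero: "\<And>x i. (\<And>f. f \<in> F \<Longrightarrow> f x = 0) \<Longrightarrow> h x \<noteq> 0 \<Longrightarrow> i \<in> J \<Longrightarrow> x i = 0"
  shows "card J \<le> card F"
proof (rule ccontr)
  assume "\<not> ?thesis"
  then have less: "card F < card J" by simp
  define I where "I = {\<Sum>f\<in>F. q f * f |q. \<forall>f\<in>F. q f \<in> polys J}"
  have I: "poly_ideal J I"
    unfolding poly_ideal_def
  proof (intro conjI ballI)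
    show "I \<subseteq> polys J" unfolding I_def using F by (auto intro!: polys_sum polys.mult)
    show "0 \<in> I" unfolding I_def by (auto intro!: exI[of _ "\<lambda>_. 0"] polys_0)
    fix f assume "f \<in> I"
    then obtain q where q: "f = (\<Sum>f\<in>F. q f * f)" "\<forall>f\<in>F. q f \<in> polys J" unfolding I_def by blast
    {
      fix g assume "g \<in> I"
      then obtain q' where q': "g = (\<Sum>f\<in>F. q' f * f)" "\<forall>f\<in>F. q' f \<in> polys J" unfolding I_def by blast
      have "f + g = (\<Sum>f\<in>F. (q f + q' f) * f)"
        unfolding q q' by (simp only: distrib_right sum.distrib)
      moreover have "\<forall>f\<in>F. q f + q' f \<in> polys J" using q q' by (intro ballI polys.add) blast+
      ultimately show "f + g \<in> I" unfolding I_def by (intro CollectI exI[of _ "\<lambda>f. q f + q' f"]) blast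
    next
      fix s :: "('a \<Rightarrow> complex) \<Rightarrow> complex" assume s: "s \<in> polys J"
      have "s * f = (\<Sum>f\<in>F. (s * q f) * f)"
        unfolding q by (simp only: sum_distrib_left mult.assoc)
      moreover have "\<forall>f\<in>F. s * q f \<in> polys J" using q s by (intro ballI polys.mult) blast+
      ultimately show "s * f \<in> I" unfolding I_def by (intro CollectI exI[of _ "\<lambda>f. s * q f"]) blast
    }
  qed
  have FI: "f \<in> I" if "f \<in> F" for f
  proof -
    have "f = (\<Sum>g\<in>F. (if g = f then 1 else 0) * g)"
      using that F(1) by (subst sum.remove[of _ f]) (auto intro!: sum.neutral)
    then show ?thesis unfolding I_def using polys_0[of J] polys_1[of J]
      by (intro CollectI exI[of _ "\<lambda>g. if g = f then 1 else 0"]) (auto)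
  qed
  define X where "X i = (\<lambda>x::'a \<Rightarrow> complex. x i)" for i
  have X: "X i \<in> polys J" if "i \<in> J" for i unfolding X_def using that by (rule polys.var)
  \<comment> \<open>Normalised to value 1 at the origin, so that 1 - h1 vanishes there and a
    geometric series inverts \<open>h1\<close> up to any order.\<close>
  define h1 where "h1 = fscale (1 / h (\<lambda>_. 0)) h"
  have h1: "h1 \<in> polys J" "h1 (\<lambda>_. 0) = 1"
    using h polys_fscale by (auto simp: h1_def fscale_apply)
  have "\<exists>r. (h1 * X i) ^ r \<in> I" if "i \<in> J" for i
  proof (rule nullstellensatz[OF J I])
    show "h1 * X i \<in> polys J" using h1 X that by (intro polys.mult)
    fix x assume "\<And>f. f \<in> I \<Longrightarrow> f x = 0"
    then have "h x \<noteq> 0 \<Longrightarrow> x i = 0" using zero[of x i] FI that by blast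
    then show "(h1 * X i) x = 0" by (auto simp: h1_def fscale_apply X_def fun_arith_apply)
  qed
  then obtain r0 where r0: "\<And>i. i \<in> J \<Longrightarrow> (h1 * X i) ^ r0 i \<in> I" by metis
  define r where "r = Max (insert 0 (r0 ` J))"
  have r: "(h1 * X i) ^ r \<in> I" if "i \<in> J" for i
  proof -
    have "r0 i \<le> r" unfolding r_def using that J by (intro Max_ge) auto
    then have "(h1 * X i) ^ r = (h1 * X i) ^ (r - r0 i) * (h1 * X i) ^ r0 i"
      by (simp only: power_add[symmetric] le_add_diff_inverse2)
    also have "\<dots> \<in> I" using r0[OF that] h1 X[OF that] by (intro poly_idealD(4)[OF I] polys_power polys.mult)
    finally show ?thesis .
  qed
  have Xr: "X i ^ r \<in> fs.span (I \<union> (ord_ge k \<inter> polys J))" if i: "i \<in> J" for i k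
  proof -
    define g where "g = 1 - h1"
    have g: "g \<in> polys J" "g \<in> ord_ge 1"
      using h1 polys_ord_ge_1[of "1 - h1" J] polys_diff[OF polys_1 h1(1)]
      by (auto simp: g_def fun_arith_apply)
    \<comment> \<open>\<open>u\<close> is the truncated geometric series for the inverse of
      \<open>h1\<close>, with error g^k; \<open>w\<close> carries this error through the r-th power.
      This removes the factor \<open>h1\<close> from the powers supplied by the
      Nullstellensatz.\<close>
    define u where "u = (\<Sum>j<k. g ^ j)"
    define w where "w = (\<Sum>j<r. (1 - g ^ k) ^ j)"
    have u: "u \<in> polys J" "w \<in> polys J"
      unfolding u_def w_def using g by (auto intro!: polys_sum polys_power polys_diff polys_1)
    have "h1 * u = 1 - g ^ k"
      unfolding u_def one_diff_power_eq by (simp add: g_def)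
    moreover have "1 - (1 - g ^ k) ^ r = g ^ k * w"
      unfolding w_def one_diff_power_eq[of "1 - g ^ k"] by (simp only: diff_diff_eq2 add_diff_cancel_left')
    ultimately have "1 - (h1 * u) ^ r = g ^ k * w" by (simp only:)
    then have "X i ^ r = (h1 * u) ^ r * X i ^ r + (g ^ k * w) * X i ^ r"
      by (simp only: distrib_right[symmetric] add_diff_cancel_left' diff_add_eq[symmetric])
         (metis add.commute diff_add_cancel mult_1)
    then have "X i ^ r = u ^ r * (h1 * X i) ^ r + g ^ k * (w * X i ^ r)"
      by (simp only: power_mult_distrib mult_ac)
    moreover have "u ^ r * (h1 * X i) ^ r \<in> I" using r[OF i] u by (intro poly_idealD(4)[OF I] polys_power)
    moreover have "g ^ k * (w * X i ^ r) \<in> ord_ge k \<inter> polys J"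
      using ord_ge_mult[OF ord_ge_power[OF g(2), of k] polys_ord_ge_0, of "w * X i ^ r" J] u g X[OF i]
      by (auto intro!: polys.mult polys_power)
    ultimately show ?thesis by (metis UnCI fs.span_add fs.span_base)
  qed
  define E where "E = monom_fun J ` PiE J (\<lambda>_. {..<r})"
  have IO: "q * f \<in> fs.span (I \<union> (ord_ge k \<inter> polys J))"
    if "f \<in> fs.span (I \<union> (ord_ge k \<inter> polys J))" "q \<in> polys J" for f q k
    using that(1)
  proof (induction rule: fs.span_induct_alt)
    case base
    show ?case by (simp only: mult_zero_right fs.span_zero)
  next
    case (step c f g)
    have "q * f \<in> I \<union> (ord_ge k \<inter> polys J)"
      using step(1) poly_idealD(4)[OF I that(2)] ord_ge_mult[OF polys_ord_ge_0[OF that(2)], of f k]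
        polys.mult[OF that(2)] by auto
    moreover have "q * (fscale c f + g) = fscale c (q * f) + q * g"
      by (auto simp: fun_eq_iff fun_arith_apply fscale_apply algebra_simps)
    ultimately show ?case using step(2) by (metis fs.span_add fs.span_base fs.span_scale)
  qed
  \<comment> \<open>A monomial with some exponent at least \<open>r\<close> is a multiple of x_i^r,
    so it is absorbed by \<open>I\<close> and the terms of order \<open>k\<close>. The set
    \<open>E\<close> of the others does not grow with \<open>k\<close>.\<close>
  have red: "p \<in> fs.span (E \<union> (I \<union> (ord_ge k \<inter> polys J)))" if "p \<in> polys J" for p k
  proof -
    let ?T = "fs.span (E \<union> (I \<union> (ord_ge k \<inter> polys J)))"
    have "monom_fun J \<alpha> \<in> ?T" for \<alpha>
    proof (cases "\<forall>i\<in>J. \<alpha> i < r")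
      case True
      have "monom_fun J \<alpha> = monom_fun J (restrict \<alpha> J)" by (auto simp: monom_fun_def fun_eq_iff)
      moreover have "restrict \<alpha> J \<in> PiE J (\<lambda>_. {..<r})" using True by auto
      ultimately have "monom_fun J \<alpha> \<in> E" unfolding E_def by (metis imageI)
      then show ?thesis by (intro fs.span_base) auto
    next
      case False
      then obtain i where i: "i \<in> J" "r \<le> \<alpha> i" by force
      have "monom_fun J \<alpha> = monom_fun J (\<alpha>(i := \<alpha> i - r)) * X i ^ r"
      proof
        fix x :: "'a \<Rightarrow> complex"
        have "(\<Prod>j\<in>J-{i}. x j ^ (\<alpha>(i := \<alpha> i - r)) j) = (\<Prod>j\<in>J-{i}. x j ^ \<alpha> j)"
          by (intro prod.cong) auto
        moreover have "x i ^ \<alpha> i = x i ^ (\<alpha> i - r) * x i ^ r" using i by (simp flip: power_add)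
        ultimately show "monom_fun J \<alpha> x = (monom_fun J (\<alpha>(i := \<alpha> i - r)) * X i ^ r) x"
          using J i by (simp add: monom_fun_def X_def power_fun_apply fun_arith_apply prod.remove[of J i])
      qed
      also have "\<dots> \<in> fs.span (I \<union> (ord_ge k \<inter> polys J))"
        by (rule IO[OF Xr[OF i(1)] monom_fun_polys])
      also have "\<dots> \<subseteq> ?T" by (intro fs.span_mono) auto
      finally show ?thesis .
    qed
    then have "fs.span (range (monom_fun J)) \<subseteq> ?T" by (intro fs.span_minimal fs.subspace_span) auto
    then show ?thesis using polys_subset_span_monom_fun[OF J that] by auto
  qed
  define Fpow where "Fpow \<beta> = (\<Prod>f\<in>F. f ^ \<beta> f)" for \<beta> :: "(('a \<Rightarrow> complex) \<Rightarrow> complex) \<Rightarrow> nat"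
  have Fpow_polys: "Fpow \<beta> \<in> polys J" for \<beta> unfolding Fpow_def using F by (auto intro!: polys_prod polys_power)
  have Fpow_ord: "Fpow \<beta> \<in> ord_ge (sum \<beta> F)" for \<beta>
    unfolding Fpow_def using ord_ge_power[OF polys_ord_ge_1, of _ J] F by (intro ord_ge_prod) force
  define UB where "UB k = (\<lambda>(\<beta>, e). Fpow \<beta> * e) ` (PiE F (\<lambda>_. {..<k}) \<times> E)" for k
  \<comment> \<open>Induction on the missing degree \<open>d\<close>. Reducing \<open>p\<close>
    leaves elements of \<open>E\<close>, terms of order \<open>k\<close>, and an element of
    \<open>I\<close>; the latter is a combination of elements of \<open>F\<close>, each of which
    raises the exponent sum by one. Since \<open>F\<close> vanishes at the origin, an exponent sum
    of at least \<open>k\<close> gives order \<open>k\<close>.\<close>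
  have jets: "Fpow \<beta> * p \<in> fs.span (UB k \<union> ord_ge k)" if "p \<in> polys J" "k \<le> sum \<beta> F + d" for p \<beta> k d
    using that
  proof (induction d arbitrary: p \<beta>)
    case 0
    then show ?case
      using ord_ge_mono[OF ord_ge_mult[OF Fpow_ord polys_ord_ge_0]] by (intro fs.span_base) auto
  next
    case (Suc d)
    show ?case
    proof (cases "k \<le> sum \<beta> F + d")
      case True
      then show ?thesis using Suc by blast
    next
      case False
      then have \<beta>: "\<beta> f < k" if "f \<in> F" for f using member_le_sum[of f F \<beta>] that F(1) by auto
      have main: "Fpow \<beta> * q \<in> fs.span (UB k \<union> ord_ge k)" if "q \<in> E \<union> (I \<union> (ord_ge k \<inter> polys J))" for q
        using that
      proof (elim UnE)
        assume "q \<in> E"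
        have "Fpow \<beta> = Fpow (restrict \<beta> F)" by (auto simp: Fpow_def)
        moreover have "restrict \<beta> F \<in> PiE F (\<lambda>_. {..<k})" using \<beta> by auto
        ultimately have "Fpow \<beta> * q \<in> UB k" unfolding UB_def using \<open>q \<in> E\<close> by force
        then show ?thesis by (intro fs.span_base) auto
      next
        assume "q \<in> I"
        then obtain s where s: "q = (\<Sum>f\<in>F. s f * f)" "\<forall>f\<in>F. s f \<in> polys J" unfolding I_def by blast
        have "Fpow \<beta> * (s f * f) \<in> fs.span (UB k \<union> ord_ge k)" if f: "f \<in> F" for f
        proof -
          have "(\<Prod>g\<in>F-{f}. g ^ (\<beta>(f := Suc (\<beta> f))) g) = (\<Prod>g\<in>F-{f}. g ^ \<beta> g)"
            by (intro prod.cong) auto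
          then have "Fpow \<beta> * (s f * f) = Fpow (\<beta>(f := Suc (\<beta> f))) * s f"
            unfolding Fpow_def prod.remove[OF F(1) f] by (simp add: mult_ac)
          moreover have "sum (\<beta>(f := Suc (\<beta> f))) F = Suc (sum \<beta> F)"
            using F(1) f by (simp add: sum.remove)
          moreover have "Fpow (\<beta>(f := Suc (\<beta> f))) * s f \<in> fs.span (UB k \<union> ord_ge k)"
            using s(2) f Suc.prems(2) calculation(2) by (intro Suc.IH) (auto simp del: fun_upd_apply)
          ultimately show ?thesis by (simp only:)
        qed
        then show ?thesis unfolding s(1) sum_distrib_left by (intro fs.span_sum)
      next
        assume "q \<in> ord_ge k \<inter> polys J"
        then have "Fpow \<beta> * q \<in> ord_ge k"
          using ord_ge_mult[OF polys_ord_ge_0[OF Fpow_polys], of q k \<beta>] by simp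
        then show ?thesis by (intro fs.span_base) auto
      qed
      from red[OF Suc.prems(1), of k] show ?thesis
      proof (induction rule: fs.span_induct_alt)
        case base
        show ?case by (simp only: mult_zero_right fs.span_zero)
      next
        case (step c f g)
        have "Fpow \<beta> * (fscale c f + g) = fscale c (Fpow \<beta> * f) + Fpow \<beta> * g"
          by (auto simp: fun_eq_iff fun_arith_apply fscale_apply algebra_simps)
        then show ?case using step main by (metis fs.span_add fs.span_scale)
      qed
    qed
  qed
  \<comment> \<open>The K^|J| monomials with exponents below \<open>K\<close> have degree below k =
    |J| K. The spanning set has at most k^|F| r^|J| elements, which is K^|F| times a constant;
    \<open>K\<close> is chosen to exceed that constant, and |F| < |J| does the rest.\<close>
  define K where "K = Suc (card J ^ card F * r ^ card J)"
  define k where "k = card J * K"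
  define A where "A = PiE J (\<lambda>_. {..<K})"
  have A: "finite A" "card A = K ^ card J"
    unfolding A_def using J by (auto simp: finite_PiE card_PiE)
  have UB: "finite (UB k)" unfolding UB_def E_def using J F by (auto intro!: finite_PiE)
  have "card (UB k) \<le> card (PiE F (\<lambda>_. {..<k}) \<times> E)"
    unfolding UB_def E_def using J F by (intro card_image_le finite_cartesian_product finite_PiE finite_imageI) auto
  also have "\<dots> \<le> k ^ card F * r ^ card J"
    using card_image_le[of "PiE J (\<lambda>_. {..<r})" "monom_fun J"] J F
    by (auto simp: card_cartesian_product card_PiE E_def finite_PiE)
  also have "\<dots> = K ^ card F * (card J ^ card F * r ^ card J)" by (simp add: k_def power_mult_distrib)
  also have "\<dots> < K ^ card F * K" by (simp add: K_def)
  also have "\<dots> = K ^ Suc (card F)" by simp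
  also have "\<dots> \<le> K ^ card J" using less by (intro power_increasing) (auto simp: K_def)
  finally have card: "card (UB k) < card A" using A by simp
  have "\<exists>u. u \<in> fs.span (UB k) \<and> monom_fun J \<alpha> - u \<in> ord_ge k" for \<alpha>
  proof -
    have "Fpow (\<lambda>_. 0) = 1" by (simp add: Fpow_def)
    then have "monom_fun J \<alpha> \<in> fs.span (UB k \<union> ord_ge k)"
      using jets[OF monom_fun_polys[of J \<alpha>], of k "\<lambda>_. 0" k] by simp
    then obtain u v where "monom_fun J \<alpha> = u + v" "u \<in> fs.span (UB k)" "v \<in> fs.span (ord_ge k)"
      unfolding fs.span_Un by blast
    moreover from this have "v \<in> ord_ge k" using fs.span_eq_iff subspace_ord_ge by metis
    ultimately show ?thesis by (intro exI[of _ u]) auto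
  qed
  then obtain u where u: "\<And>\<alpha>. u \<alpha> \<in> fs.span (UB k)" "\<And>\<alpha>. monom_fun J \<alpha> - u \<alpha> \<in> ord_ge k" by metis
  obtain c \<alpha> where c: "\<alpha> \<in> A" "c \<alpha> \<noteq> 0" "(\<Sum>\<alpha>\<in>A. fscale (c \<alpha>) (u \<alpha>)) = 0"
    using dependent_family[OF A(1) UB card] u(1) by metis
  have "(\<Sum>\<alpha>\<in>A. fscale (c \<alpha>) (monom_fun J \<alpha> - u \<alpha>)) \<in> ord_ge k"
    by (intro fs.subspace_sum[OF subspace_ord_ge] fs.subspace_scale[OF subspace_ord_ge] u)
  moreover have "(\<Sum>\<alpha>\<in>A. fscale (c \<alpha>) (monom_fun J \<alpha> - u \<alpha>)) = (\<Sum>\<alpha>\<in>A. fscale (c \<alpha>) (monom_fun J \<alpha>))"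
    using c(3) by (simp only: fs.scale_right_diff_distrib sum_subtractf diff_zero)
  ultimately have "(\<Sum>\<alpha>\<in>A. fscale (c \<alpha>) (monom_fun J \<alpha>)) \<in> ord_ge k" by simp
  moreover have "sum \<alpha> J < k" if "\<alpha> \<in> A" for \<alpha>
  proof -
    have "sum \<alpha> J < (\<Sum>i\<in>J. K)"
      using less that J unfolding A_def by (intro sum_strict_mono) auto
    then show ?thesis by (simp add: k_def)
  qed
  ultimately have "(\<Sum>\<alpha>\<in>A. c \<alpha> * monom_fun J \<alpha> x) = 0" for x
    using monom_fun_ord_ge_zero[OF J A(1)] by blast
  then have "c \<alpha> = 0" using monom_fun_independent[OF J] c(1) unfolding A_def by blast
  then show False using c by simp
qed

section \<open>Equivariant maps and traces\<close>

definition diag_mat :: "('p \<Rightarrow> complex) \<Rightarrow> complex ^ 'p ^ 'p" where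
  "diag_mat d = (\<chi> i j. if i = j then d i else 0)"

lemma diag_mat_mult: "diag_mat d ** diag_mat e = diag_mat (\<lambda>i. d i * e i)"
  by (simp add: diag_mat_def matrix_matrix_mult_def vec_eq_iff if_distrib[of "\<lambda>x. x * _"] sum.delta cong: if_cong)

lemma mat_eq_diag_mat: "mat c = diag_mat (\<lambda>_. c)"
  by (simp add: mat_def diag_mat_def)

lemma diag_mat_add: "diag_mat d + diag_mat e = diag_mat (\<lambda>i. d i + e i)"
  by (simp add: diag_mat_def vec_eq_iff)

lemma trace_diag_mat: "trace (diag_mat d) = (\<Sum>i\<in>UNIV. d i)"
  by (simp add: trace_def diag_mat_def)

lemma diag_mat_conj_nth: "(diag_mat d ** A ** diag_mat e) $ i $ j = d i * A $ i $ j * e j"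
  by (simp add: diag_mat_def matrix_matrix_mult_def if_distrib[of "\<lambda>x. x * _"]
      if_distrib[of "\<lambda>x. _ * x"] sum.delta sum.delta' cong: if_cong)

text \<open>Polynomial maps to matrices that commute with conjugation. They are closed under sums
  and matrix products, so traces of words in them supply explicit invariants.\<close>

definition equivariants :: "(('n::finite, 'p::finite) mat_tuple \<Rightarrow> complex ^ 'p ^ 'p) set" where
  "equivariants = {\<Phi>. (\<forall>i j. (\<lambda>A. \<Phi> A $ i $ j) \<in> poly_funs) \<and>
     (\<forall>g\<in>GL. \<forall>A. \<Phi> (sim_conj g A) = g ** \<Phi> A ** matrix_inv g)}"

lemma poly_funs_sum: "(\<And>a. a \<in> S \<Longrightarrow> f a \<in> poly_funs) \<Longrightarrow> (\<lambda>A. \<Sum>a\<in>S. f a A) \<in> poly_funs"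
  by (induction S rule: infinite_finite_induct) (auto intro: poly_funs.intros)

lemma GL_inv:
  assumes "g \<in> GL"
  shows "matrix_inv g ** g = mat 1" "g ** matrix_inv g = mat 1"
  using assms someI_ex[of "\<lambda>A'. g ** A' = mat 1 \<and> A' ** g = mat 1"]
  by (auto simp: GL_def invertible_def matrix_inv_def)

lemma GL_I:
  assumes "g ** g' = mat 1" "g' ** g = mat 1"
  shows "g \<in> GL" "matrix_inv g = g'"
proof -
  show g: "g \<in> GL" using assms by (auto simp: GL_def invertible_def)
  show "matrix_inv g = g'" by (metis GL_inv(1)[OF g] assms(1) matrix_mul_assoc matrix_mul_lid matrix_mul_rid)
qed

lemma matrix_add_mult_distrib: "(A + B) ** C = A ** C + B ** C"
  for A B :: "complex ^ 'p ^ 'q"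
  by (simp add: vec_eq_iff matrix_matrix_mult_def sum.distrib distrib_right)

lemma equivariants_proj: "(\<lambda>A. A $ k) \<in> equivariants"
  by (auto simp: equivariants_def sim_conj_def intro: poly_funs.coord)

lemma equivariants_mat: "(\<lambda>A :: ('n::finite, 'p::finite) mat_tuple. mat c) \<in> equivariants"
proof -
  have "g ** mat c ** matrix_inv g = mat c" if "g \<in> GL" for g :: "complex ^ 'p ^ 'p"
  proof -
    have "g ** mat c = mat c ** g"
      by (simp add: vec_eq_iff matrix_matrix_mult_def mat_def if_distrib[of "\<lambda>x. x * _"]
      if_distrib[of "\<lambda>x. _ * x"] sum.delta sum.delta' mult.commute cong: if_cong)
    then show ?thesis using GL_inv[OF that] by (metis matrix_mul_assoc matrix_mul_rid)
  qed
  then show ?thesis by (simp add: equivariants_def poly_funs.const)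
qed

lemma equivariants_add:
  assumes "\<Phi> \<in> equivariants" "\<Psi> \<in> equivariants"
  shows "(\<lambda>A. \<Phi> A + \<Psi> A) \<in> equivariants"
  using assms by (auto simp: equivariants_def matrix_add_ldistrib matrix_add_mult_distrib intro: poly_funs.add)

lemma equivariants_mult:
  fixes \<Phi> \<Psi> :: "('n::finite, 'p::finite) mat_tuple \<Rightarrow> complex ^ 'p ^ 'p"
  assumes "\<Phi> \<in> equivariants" "\<Psi> \<in> equivariants"
  shows "(\<lambda>A. \<Phi> A ** \<Psi> A) \<in> equivariants"
proof -
  have 1: "(g ** X ** matrix_inv g) ** (g ** Y ** matrix_inv g) = g ** (X ** Y) ** matrix_inv g"
    if "g \<in> GL" for g X Y :: "complex ^ 'p ^ 'p"
    by (metis GL_inv(1)[OF that] matrix_mul_assoc matrix_mul_rid)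
  have "(\<lambda>A. (\<Phi> A ** \<Psi> A) $ i $ j) \<in> poly_funs" for i j
    using assms by (auto simp: equivariants_def matrix_matrix_mult_def intro!: poly_funs_sum poly_funs.mult)
  moreover have "\<Phi> (sim_conj g A) ** \<Psi> (sim_conj g A) = g ** (\<Phi> A ** \<Psi> A) ** matrix_inv g" if "g \<in> GL" for g A
    using assms that 1[OF that] by (simp add: equivariants_def)
  ultimately show ?thesis by (simp add: equivariants_def)
qed

lemma trace_equivariant:
  fixes \<Phi> :: "('n::finite, 'p::finite) mat_tuple \<Rightarrow> complex ^ 'p ^ 'p"
  assumes "\<Phi> \<in> equivariants"
  shows "(\<lambda>A. trace (\<Phi> A)) \<in> invariants"
proof -
  have 1: "trace (g ** X ** matrix_inv g) = trace X" if "g \<in> GL" for g X :: "complex ^ 'p ^ 'p"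
    by (metis GL_inv(1)[OF that] matrix_mul_assoc matrix_mul_lid trace_mul_sym)
  have "(\<lambda>A. trace (\<Phi> A)) \<in> poly_funs"
    using assms by (auto simp: equivariants_def trace_def intro!: poly_funs_sum)
  moreover have "trace (\<Phi> (sim_conj g A)) = trace (\<Phi> A)" if "g \<in> GL" for g A
    using assms that 1[OF that] by (simp add: equivariants_def)
  ultimately show ?thesis by (simp add: invariants_def)
qed

text \<open>The map is \<open>P\<close> applied to matrix number \<open>k\<close>; only its values
  at diagonal matrices are recorded.\<close>

lemma equivariant_poly:
  fixes k :: "'n::finite"
  shows "\<exists>\<Phi>\<in>equivariants. \<forall>(A :: ('n, 'p::finite) mat_tuple) d. A $ k = diag_mat d \<longrightarrow> \<Phi> A = diag_mat (\<lambda>i. poly P (d i))"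
proof (induction P)
  case 0
  then show ?case by (intro bexI[OF _ equivariants_mat[of 0]]) (auto simp: mat_eq_diag_mat)
next
  case (pCons a P)
  then obtain \<Phi> where \<Phi>: "\<Phi> \<in> equivariants"
    "\<And>(A :: ('n, 'p) mat_tuple) d. A $ k = diag_mat d \<Longrightarrow> \<Phi> A = diag_mat (\<lambda>i. poly P (d i))"
    by blast
  have "(\<lambda>A. mat a + A $ k ** \<Phi> A) \<in> equivariants"
    by (intro equivariants_add equivariants_mat equivariants_mult equivariants_proj \<Phi>)
  then show ?case
    by (rule bexI[rotated]) (auto simp: \<Phi>(2) mat_eq_diag_mat diag_mat_mult diag_mat_add)
qed

lemma interpolation_poly:
  assumes "finite T"
  shows "\<exists>P::complex poly. \<forall>y\<in>T. poly P y = (if y = x then 1 else 0)"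
proof -
  define Q where "Q = (\<Prod>y\<in>T-{x}. [:-y, 1:])"
  have "poly Q x \<noteq> 0" using assms by (auto simp: Q_def poly_prod)
  moreover have "poly Q y = 0" if "y \<in> T" "y \<noteq> x" for y
    using assms that by (auto simp: Q_def poly_prod)
  ultimately show ?thesis by (intro exI[of _ "smult (1 / poly Q x) Q"]) auto
qed

text \<open>The part of having equal invariants on which the rigidity of the slice rests.\<close>

definition same_traces :: "('n::finite, 'p::finite) mat_tuple \<Rightarrow> ('n, 'p) mat_tuple \<Rightarrow> bool" where
  "same_traces v w \<longleftrightarrow> (\<forall>\<Phi>\<in>equivariants. trace (\<Phi> v) = trace (\<Phi> w))"

lemma same_traces_sym: "same_traces v w \<Longrightarrow> same_traces w v"
  by (auto simp: same_traces_def)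

text \<open>With a polynomial that is 1 at one eigenvalue and 0 at the others, the trace counts the
  multiplicity of that eigenvalue.\<close>

lemma same_traces_range_diag:
  assumes "same_traces v w" "v $ k = diag_mat d" "w $ k = diag_mat e"
  shows "range e \<subseteq> range d"
proof (rule ccontr)
  assume "\<not> ?thesis"
  then obtain i where i: "e i \<notin> range d" by auto
  obtain P where P: "\<forall>y\<in>range d \<union> range e. poly P y = (if y = e i then 1 else 0)"
    using interpolation_poly[of "range d \<union> range e" "e i"] by auto
  obtain \<Phi> where \<Phi>: "\<Phi> \<in> equivariants" "\<Phi> v = diag_mat (\<lambda>i. poly P (d i))" "\<Phi> w = diag_mat (\<lambda>i. poly P (e i))"
    using equivariant_poly[of k P] assms by metis
  have "(\<Sum>j\<in>UNIV. poly P (d j)) = 0" using P i by (intro sum.neutral) (metis UnI1 rangeI)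
  moreover have "(\<Sum>j\<in>UNIV. poly P (e j)) = (\<Sum>j\<in>UNIV. if e j = e i then 1 else 0)"
    using P by (intro sum.cong) auto
  moreover have "\<dots> = of_nat (card {j. e j = e i})" by (simp add: sum.If_cases)
  moreover have "card {j. e j = e i} \<noteq> 0" by (auto simp: card_eq_0_iff)
  ultimately show False using assms(1) \<Phi> unfolding same_traces_def by (metis of_nat_eq_0_iff trace_diag_mat)
qed

section \<open>Matrix units and products of entries along cycles\<close>

definition single_mat :: "complex \<Rightarrow> 'p \<Rightarrow> 'p \<Rightarrow> complex ^ 'p ^ 'p" where
  "single_mat c i j = (\<chi> r s. if r = i \<and> s = j then c else 0)"

text \<open>One step of a path: a coefficient collected on the way from \<open>j\<close> to
  \<open>i\<close> is multiplied by the entry of \<open>M\<close> leading from \<open>i\<close> to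
  \<open>l\<close>.\<close>

lemma single_mat_mult: "single_mat c j i ** M ** single_mat 1 l l = single_mat (c * M $ i $ l) j l"
proof -
  have "(single_mat c j i ** M) $ r $ s = (if r = j then c * M $ i $ s else 0)" for r s
    by (auto simp: single_mat_def matrix_matrix_mult_def if_distrib[of "\<lambda>x. x * _"] sum.delta cong: if_cong)
  then have "(single_mat c j i ** M ** single_mat 1 l l) $ r $ s = (if r = j \<and> s = l then c * M $ i $ l else 0)" for r s
    unfolding matrix_matrix_mult_def[of "single_mat c j i ** M"]
    by (auto simp: single_mat_def if_distrib[of "\<lambda>x. _ * x"] sum.delta cong: if_cong)
  then show ?thesis by (simp add: vec_eq_iff single_mat_def)
qed

lemma trace_mult_single_mat: "trace (M ** single_mat c j i) = M $ i $ j * c"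
proof -
  have "(M ** single_mat c j i) $ r $ r = (if r = i then M $ i $ j * c else 0)" for r
    by (auto simp: single_mat_def matrix_matrix_mult_def if_distrib[of "\<lambda>x. _ * x"] sum.delta cong: if_cong)
  then show ?thesis by (simp add: trace_def)
qed

lemma equivariant_single_mat:
  assumes "inj d"
  shows "\<exists>\<Phi>\<in>equivariants. \<forall>(A :: ('n::finite, 'p::finite) mat_tuple). A $ k = diag_mat d \<longrightarrow> \<Phi> A = single_mat 1 i i"
proof -
  obtain P where P: "\<forall>y\<in>range d. poly P y = (if y = d i then 1 else 0)"
    using interpolation_poly[of "range d" "d i"] by auto
  obtain \<Phi> where \<Phi>: "\<Phi> \<in> equivariants"
    "\<And>(A :: ('n, 'p) mat_tuple) d. A $ k = diag_mat d \<Longrightarrow> \<Phi> A = diag_mat (\<lambda>i. poly P (d i))"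
    using equivariant_poly[of k P] by blast
  have "diag_mat (\<lambda>i. poly P (d i)) = single_mat 1 i i"
    using P assms by (auto simp: diag_mat_def single_mat_def vec_eq_iff inj_eq)
  then show ?thesis using \<Phi> by (intro bexI[of _ \<Phi>]) auto
qed

text \<open>As \<open>d\<close> is injective, the diagonal matrix units are values of equivariant
  maps, the same for \<open>v\<close> and \<open>w\<close>. Inserting them into words isolates
  single cycles in the trace. For the third claim, an arc of \<open>v\<close> on a cycle yields a
  nonzero cycle product; the equal product for \<open>w\<close> is nonzero, so the arc lies on a
  cycle there as well.\<close>

lemma
  assumes same: "same_traces v w" and d: "inj d" "v $ k = diag_mat d" "w $ k = diag_mat d"
  shows same_traces_diag: "v $ l $ i $ i = w $ l $ i $ i"
    and same_traces_2cycle: "v $ l $ i $ j * v $ m $ j $ i = w $ l $ i $ j * w $ m $ j $ i"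
    and same_traces_cycle: "(i, j) \<in> {(i, j). v $ l $ i $ j \<noteq> 0} \<Longrightarrow> (j, i) \<in> {(i, j). v $ l $ i $ j \<noteq> 0}\<^sup>* \<Longrightarrow>
      (i, j) \<in> {(i, j). w $ l $ i $ j \<noteq> 0} \<and> (j, i) \<in> {(i, j). w $ l $ i $ j \<noteq> 0}\<^sup>*"
proof -
  obtain E where E: "\<And>i. E i \<in> equivariants" "\<And>i. E i v = single_mat 1 i i" "\<And>i. E i w = single_mat 1 i i"
    using equivariant_single_mat[OF d(1), of k] d(2,3) by metis
  have same: "trace (\<Phi> v) = trace (\<Phi> w)" if "\<Phi> \<in> equivariants" for \<Phi>
    using same that by (auto simp: same_traces_def)
  note eqv = equivariants_mult equivariants_proj E(1)
  show "v $ l $ i $ i = w $ l $ i $ i"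
    using same[of "\<lambda>A. A $ l ** E i A"] by (simp add: eqv E trace_mult_single_mat)
  show "v $ l $ i $ j * v $ m $ j $ i = w $ l $ i $ j * w $ m $ j $ i"
    using same[of "\<lambda>A. A $ l ** (E j A ** A $ m ** E i A)"]
    by (simp add: eqv E trace_mult_single_mat single_mat_mult)
  \<comment> \<open>The coefficients \<open>c\<close> and \<open>c'\<close> are the products of the
    entries of \<open>v\<close> and of \<open>w\<close> along one and the same sequence of
    indices.\<close>
  have path: "\<exists>\<Phi>\<in>equivariants. \<exists>c c'. \<Phi> v = single_mat c j i \<and> \<Phi> w = single_mat c' j i \<and> c \<noteq> 0
      \<and> (c' \<noteq> 0 \<longrightarrow> (j, i) \<in> {(i, j). w $ l $ i $ j \<noteq> 0}\<^sup>*)"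
    if "(j, i) \<in> {(i, j). v $ l $ i $ j \<noteq> 0}\<^sup>*" for i j
    using that
  proof (induction rule: rtrancl_induct)
    case base
    then show ?case using E by (intro bexI[of _ "E j"] exI[of _ 1]) auto
  next
    case (step i m)
    then obtain \<Phi> c c' where \<Phi>: "\<Phi> \<in> equivariants" "\<Phi> v = single_mat c j i" "\<Phi> w = single_mat c' j i" "c \<noteq> 0"
      "c' \<noteq> 0 \<longrightarrow> (j, i) \<in> {(i, j). w $ l $ i $ j \<noteq> 0}\<^sup>*" by blast
    have a: "(\<lambda>A. \<Phi> A ** A $ l ** E m A) \<in> equivariants" by (intro eqv \<Phi>)
    have b: "(j, m) \<in> {(i, j). w $ l $ i $ j \<noteq> 0}\<^sup>*" if "c' * w $ l $ i $ m \<noteq> 0"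
    proof (rule rtrancl_into_rtrancl)
      show "(j, i) \<in> {(i, j). w $ l $ i $ j \<noteq> 0}\<^sup>*" using that \<Phi>(5) by (metis mult_eq_0_iff)
      show "(i, m) \<in> {(i, j). w $ l $ i $ j \<noteq> 0}" using that by simp
    qed
    have c: "c * v $ l $ i $ m \<noteq> 0" using \<Phi>(4) step(2) by simp
    have d: "\<Phi> v ** v $ l ** E m v = single_mat (c * v $ l $ i $ m) j m"
      "\<Phi> w ** w $ l ** E m w = single_mat (c' * w $ l $ i $ m) j m"
      by (simp_all only: \<Phi> E single_mat_mult)
    show ?case by (intro bexI[OF _ a] exI conjI impI, rule d, rule d, rule c, erule b)
  qed
  assume ij: "(i, j) \<in> {(i, j). v $ l $ i $ j \<noteq> 0}" "(j, i) \<in> {(i, j). v $ l $ i $ j \<noteq> 0}\<^sup>*"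
  obtain \<Phi> c c' where \<Phi>: "\<Phi> \<in> equivariants" "\<Phi> v = single_mat c j i" "\<Phi> w = single_mat c' j i" "c \<noteq> 0"
      "c' \<noteq> 0 \<longrightarrow> (j, i) \<in> {(i, j). w $ l $ i $ j \<noteq> 0}\<^sup>*" using path[OF ij(2)] by blast
  have "v $ l $ i $ j * c = w $ l $ i $ j * c'"
    using same[of "\<lambda>A. A $ l ** \<Phi> A"] by (simp add: eqv \<Phi> trace_mult_single_mat)
  moreover have "v $ l $ i $ j * c \<noteq> 0" using ij \<Phi> by auto
  ultimately show "(i, j) \<in> {(i, j). w $ l $ i $ j \<noteq> 0} \<and> (j, i) \<in> {(i, j). w $ l $ i $ j \<noteq> 0}\<^sup>*"
    using \<Phi>(5) by auto
qed

text \<open>Conjugation by \<open>diag (t^(- \<rho> i))\<close> degenerates a triangular tuple to its diagonal part as \<open>t\<close> tends to 0.\<close>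

lemma invariant_triangular:
  fixes A :: "('n::finite, 'p::finite) mat_tuple" and \<rho> :: "'p \<Rightarrow> nat"
  assumes f: "f \<in> invariants" and \<rho>: "inj \<rho>" and A: "\<And>k i j. \<rho> j < \<rho> i \<Longrightarrow> A $ k $ i $ j = 0"
  shows "f A = f (\<chi> k i j. if i = j then A $ k $ i $ j else 0)"
proof -
  \<comment> \<open>The truncated subtraction is harmless: where it truncates, the entry of
    \<open>A\<close> is 0. On the diagonal the exponent is 0, so those entries survive at t = 0,
    where \<open>M\<close> is no longer given by a conjugation and the value of \<open>f\<close> is
    found by polynomial continuation.\<close>
  define M where "M t = (\<chi> k i j. t ^ (\<rho> j - \<rho> i) * A $ k $ i $ j)" for t :: complex
  have "\<exists>q. \<forall>t. f (M t) = poly q t" if "f \<in> poly_funs" for f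
    using that
  proof induction
    case (const c)
    then show ?case by (intro exI[of _ "[:c:]"]) auto
  next
    case (coord k i j)
    then show ?case by (intro exI[of _ "monom (A $ k $ i $ j) (\<rho> j - \<rho> i)"]) (auto simp: M_def poly_monom)
  next
    case (add f h)
    then obtain q q' where "\<forall>t. f (M t) = poly q t" "\<forall>t. h (M t) = poly q' t" by blast
    then show ?case by (intro exI[of _ "q + q'"]) auto
  next
    case (mult f h)
    then obtain q q' where "\<forall>t. f (M t) = poly q t" "\<forall>t. h (M t) = poly q' t" by blast
    then show ?case by (intro exI[of _ "q * q'"]) auto
  qed
  then obtain q where q: "\<And>t. f (M t) = poly q t" using f unfolding invariants_def by blast
  have "f (M t) = f A" if "t \<noteq> 0" for t
  proof -
    define g where "g = diag_mat (\<lambda>i. inverse t ^ \<rho> i)"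
    define g' where "g' = diag_mat (\<lambda>i. t ^ \<rho> i)"
    have inv: "g ** g' = mat 1" "g' ** g = mat 1"
      using that by (auto simp: g_def g'_def diag_mat_mult mat_eq_diag_mat power_inverse)
    note g = GL_I[OF this]
    have "sim_conj g A = M t"
      unfolding sim_conj_def g(2) M_def vec_eq_iff
    proof (intro allI, simp only: vec_lambda_beta)
      fix k i j
      show "(g ** A $ k ** g') $ i $ j = t ^ (\<rho> j - \<rho> i) * A $ k $ i $ j"
      proof (cases "\<rho> j < \<rho> i")
        case False
        then have "inverse t ^ \<rho> i * t ^ \<rho> j = t ^ (\<rho> j - \<rho> i)"
          using that by (simp add: power_diff power_inverse field_simps)
        then show ?thesis by (simp add: g_def g'_def diag_mat_conj_nth mult_ac)
      qed (simp add: g_def g'_def diag_mat_conj_nth A)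
    qed
    then show ?thesis using f g(1) unfolding invariants_def by (metis (mono_tags, lifting) mem_Collect_eq)
  qed
  then have "UNIV - {0} \<subseteq> {t. poly (q - [:f A:]) t = 0}" using q by auto
  then have "infinite {t. poly (q - [:f A:]) t = 0}"
    using infinite_UNIV_char_0[where 'a=complex] finite_subset by (metis finite_Diff2 finite.emptyI finite_insert)
  then have "q - [:f A:] = 0" using poly_roots_finite by blast
  then have "f (M 0) = f A" using q[of 0] by simp
  moreover have "M 0 = (\<chi> k i j. if i = j then A $ k $ i $ j else 0)"
  proof -
    have "\<rho> i < \<rho> j" if "i \<noteq> j" "A $ k $ i $ j \<noteq> 0" for k i j
      using that A[of j i k] \<rho> by (metis inj_eq linorder_neqE_nat)
    then show ?thesis by (fastforce simp: M_def vec_eq_iff)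
  qed
  ultimately show ?thesis by simp
qed

section \<open>The slice\<close>

lemma poly_funs_compose:
  assumes "s \<in> poly_funs" "\<And>k i j. (\<lambda>y. V y $ k $ i $ j) \<in> polys J"
  shows "(\<lambda>y. s (V y)) \<in> polys J"
  using assms(1)
proof induction
  case (add f h)
  then have "(\<lambda>y. f (V y)) + (\<lambda>y. h (V y)) \<in> polys J" by (intro polys.add)
  then show ?case by (simp add: plus_fun_def)
next
  case (mult f h)
  then have "(\<lambda>y. f (V y)) * (\<lambda>y. h (V y)) \<in> polys J" by (intro polys.mult)
  then show ?case by (simp add: times_fun_def)
qed (auto intro: assms(2) polys.const)

lemma card_strict_lower:
  fixes \<rho> :: "'p::finite \<Rightarrow> nat"
  assumes "inj \<rho>"
  shows "2 * card {(i, j). \<rho> j < \<rho> i} + CARD('p) = CARD('p) ^ 2"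
    and "card {(i, j). \<rho> j \<le> \<rho> i} = card {(i, j). \<rho> j < \<rho> i} + CARD('p)"
proof -
  let ?L = "{(i, j). \<rho> j < \<rho> i}" and ?U = "{(i, j). \<rho> i < \<rho> j}" and ?D = "range (\<lambda>i :: 'p. (i, i))"
  have "card ?U = card ?L"
    by (rule bij_betw_same_card[of prod.swap]) (auto simp: bij_betw_def inj_on_def image_def)
  moreover have D: "card ?D = CARD('p)" by (subst card_image) (auto simp: inj_on_def)
  moreover have le: "{(i, j). \<rho> j \<le> \<rho> i} = ?L \<union> ?D" using assms by (auto simp: le_less inj_eq)
  moreover have disj: "?L \<inter> ?D = {}" "(?L \<union> ?D) \<inter> ?U = {}" by auto
  moreover have "?L \<union> ?D \<union> ?U = UNIV" using assms by (auto simp: set_eq_iff image_iff) (metis inj_eq linorder_neqE_nat)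
  moreover have "card (?L \<union> ?D \<union> ?U) = card ?L + card ?D + card ?U"
    using disj by (subst card_Un_disjoint, simp, simp, blast)+ simp
  moreover have "CARD('p \<times> 'p) = CARD('p) ^ 2" by (simp add: power2_eq_square)
  ultimately show "2 * card {(i, j). \<rho> j < \<rho> i} + CARD('p) = CARD('p) ^ 2" by simp
  show "card {(i, j). \<rho> j \<le> \<rho> i} = card {(i, j). \<rho> j < \<rho> i} + CARD('p)"
    unfolding le using disj D by (subst card_Un_disjoint) auto
qed

text \<open>
  The slice: matrix number \<open>m\<close> is the fixed \<open>diag_mat d\<close> in \<open>v\<close> and a free diagonal matrix in \<open>w\<close>. The
  remaining matrices of \<open>v\<close> and \<open>w\<close> have prescribed entries above the diagonal with respect to \<open>\<rho>\<close>
  and \<open>\<rho>'\<close>; the other entries of \<open>w\<close> and the strictly lower ones of \<open>v\<close> are free. The polynomial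
  \<open>h\<close> excludes the points where the free diagonal is a nontrivial permutation of \<open>d\<close>.
\<close>

lemma card_separating_set_ge:
  fixes S :: "(('n::finite, 'p::finite) mat_tuple \<Rightarrow> complex) set"
    and \<rho> \<rho>' :: "'p \<Rightarrow> nat" and u u' :: "'n \<Rightarrow> 'p \<Rightarrow> 'p \<Rightarrow> complex"
  assumes S: "separating_set S" "finite S" and \<rho>: "inj \<rho>" "inj \<rho>'" and d: "inj d"
    and rigid: "\<And>v w :: ('n, 'p) mat_tuple.
      same_traces v w \<Longrightarrow> v $ m = diag_mat d \<Longrightarrow> w $ m = diag_mat d \<Longrightarrow>
      (\<And>k i j. k \<noteq> m \<Longrightarrow> \<rho> i < \<rho> j \<Longrightarrow> v $ k $ i $ j = u k i j) \<Longrightarrow>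
      (\<And>k i j. k \<noteq> m \<Longrightarrow> \<rho>' i < \<rho>' j \<Longrightarrow> w $ k $ i $ j = u' k i j) \<Longrightarrow>
      (\<forall>k i j. k \<noteq> m \<longrightarrow> \<rho> j < \<rho> i \<longrightarrow> v $ k $ i $ j = 0) \<and>
      (\<forall>k i j. k \<noteq> m \<longrightarrow> \<rho>' j < \<rho>' i \<longrightarrow> w $ k $ i $ j = 0)"
  shows "(CARD('n) - 1) * CARD('p) ^ 2 + CARD('p) \<le> card S"
proof -
  \<comment> \<open>The Boolean distinguishes the coordinates of \<open>v\<close>
    (\<open>False\<close>) from those of \<open>w\<close> (\<open>True\<close>).\<close>
  define J1 where "J1 = (\<lambda>(k, i, j). (False, k, i, j)) ` ((- {m}) \<times> {(i, j). \<rho> j < \<rho> i})"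
  define J2 where "J2 = (\<lambda>(k, i, j). (True, k, i, j)) ` ((- {m}) \<times> {(i, j). \<rho>' j \<le> \<rho>' i})"
  define J3 where "J3 = range (\<lambda>i :: 'p. (True, m, i, i))"
  define J where "J = J1 \<union> J2 \<union> J3"
  have "card J1 = (CARD('n) - 1) * card {(i, j). \<rho> j < \<rho> i}"
    unfolding J1_def by (subst card_image) (auto simp: inj_on_def card_cartesian_product Compl_eq_Diff_UNIV card_Diff_singleton)
  moreover have "card J2 = (CARD('n) - 1) * (card {(i, j). \<rho>' j < \<rho>' i} + CARD('p))"
    unfolding J2_def card_strict_lower(2)[OF \<rho>(2), symmetric]
    by (subst card_image) (auto simp: inj_on_def card_cartesian_product Compl_eq_Diff_UNIV card_Diff_singleton)
  moreover have "card J3 = CARD('p)" unfolding J3_def by (subst card_image) (auto simp: inj_on_def)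
  moreover have "card J = card J1 + card J2 + card J3"
    unfolding J_def by (subst card_Un_disjoint; (subst card_Un_disjoint)?) (auto simp: J1_def J2_def J3_def)
  \<comment> \<open>The number of strictly lower positions is the same for every order. Hence each
    matrix other than number \<open>m\<close> contributes p^2 coordinates even if the two orders
    differ; the free diagonal contributes the final \<open>p\<close>.\<close>
  moreover have "card {(i, j). \<rho> j < \<rho> i} + (card {(i, j). \<rho>' j < \<rho>' i} + CARD('p)) = CARD('p) ^ 2"
    using card_strict_lower(1)[OF \<rho>(1)] card_strict_lower(1)[OF \<rho>(2)] by simp
  ultimately have cardJ: "card J = (CARD('n) - 1) * CARD('p) ^ 2 + CARD('p)"
    by (simp flip: distrib_left)
  \<comment> \<open>The remaining matrices of \<open>v\<close> get diagonal 0, while the diagonals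
    in \<open>w\<close> are free; equal traces will force these to be 0 too. In \<open>W\<close> the
    free diagonal is measured from \<open>d\<close>, so that the point of interest is the
    origin.\<close>
  define V :: "(bool \<times> 'n \<times> 'p \<times> 'p \<Rightarrow> complex) \<Rightarrow> ('n, 'p) mat_tuple" where
    "V y = (\<chi> k i j. if k = m then (if i = j then d i else 0) else if \<rho> i < \<rho> j then u k i j
       else if i = j then 0 else y (False, k, i, j))" for y
  define W :: "(bool \<times> 'n \<times> 'p \<times> 'p \<Rightarrow> complex) \<Rightarrow> ('n, 'p) mat_tuple" where
    "W y = (\<chi> k i j. if k = m then (if i = j then d i + y (True, m, i, i) else 0)
       else if \<rho>' i < \<rho>' j then u' k i j else y (True, k, i, j))" for y
  define h :: "(bool \<times> 'n \<times> 'p \<times> 'p \<Rightarrow> complex) \<Rightarrow> complex" where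
    "h = (\<Prod>i\<in>UNIV. \<Prod>j\<in>-{i}. (\<lambda>y. y (True, m, i, i)) + (\<lambda>_. d i - d j))"
  have J3: "(True, m, i, i) \<in> J" for i by (auto simp: J_def J3_def)
  have VJ: "(\<lambda>y. V y $ k $ i $ j) \<in> polys J" for k i j
  proof -
    have "(False, k, i, j) \<in> J" if "k \<noteq> m" "\<not> \<rho> i < \<rho> j" "i \<noteq> j"
    proof -
      have "\<rho> j < \<rho> i" using that \<rho>(1) by (metis inj_eq linorder_neqE_nat)
      then show ?thesis using that by (auto simp: J_def J1_def image_iff)
    qed
    then show ?thesis
      by (cases "k = m"; cases "\<rho> i < \<rho> j"; cases "i = j") (auto simp: V_def intro: polys.const polys.var)
  qed
  have WJ: "(\<lambda>y. W y $ k $ i $ j) \<in> polys J" for k i j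
  proof -
    have "(True, k, i, j) \<in> J" if "k \<noteq> m" "\<not> \<rho>' i < \<rho>' j"
      using that by (auto simp: J_def J2_def image_iff)
    moreover have "(\<lambda>y. d i + y (True, m, i, i)) \<in> polys J" for i
      using polys.add[OF polys.const polys.var[OF J3[of i]], of "d i"] by (simp add: plus_fun_def)
    ultimately show ?thesis
      by (cases "k = m"; cases "\<rho>' i < \<rho>' j"; cases "i = j") (auto simp: W_def intro: polys.const polys.var)
  qed
  define F where "F = (\<lambda>s y. s (V y) - s (W y)) ` S"
  have F: "finite F" "card F \<le> card S" unfolding F_def using S(2) by (auto intro: card_image_le)
  have sub: "S \<subseteq> invariants" using S(1) by (auto simp: separating_set_def)
  have "card J \<le> card F"
  proof (rule card_le_card_isolated_zero)
    show "finite J" by simp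
    show "finite F" by fact
    have "(\<lambda>y. s (V y) - s (W y)) \<in> polys J" if "s \<in> S" for s
    proof -
      have "s \<in> poly_funs" using that sub by (auto simp: invariants_def)
      from polys_diff[OF poly_funs_compose[OF this VJ] poly_funs_compose[OF this WJ]]
      show ?thesis by (simp add: fun_diff_def)
    qed
    then show "F \<subseteq> polys J" by (auto simp: F_def)
    \<comment> \<open>At the origin both tuples are triangular, each in its own order, and have the
      same diagonal part.\<close>
    have "s (V (\<lambda>_. 0)) = s (W (\<lambda>_. 0))" if "s \<in> S" for s
    proof -
      have s: "s \<in> invariants" using that sub by auto
      have "s (V (\<lambda>_. 0)) = s (\<chi> k i j. if i = j then V (\<lambda>_. 0) $ k $ i $ j else 0)"
        by (rule invariant_triangular[OF s \<rho>(1)]) (auto simp: V_def)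
      also have "(\<chi> k i j. if i = j then V (\<lambda>_. 0) $ k $ i $ j else 0) = (\<chi> k i j. if i = j then W (\<lambda>_. 0) $ k $ i $ j else 0)"
        by (auto simp: V_def W_def vec_eq_iff)
      also have "s \<dots> = s (W (\<lambda>_. 0))"
        by (rule invariant_triangular[OF s \<rho>(2), symmetric]) (auto simp: W_def)
      finally show ?thesis .
    qed
    then show "f (\<lambda>_. 0) = 0" if "f \<in> F" for f using that by (auto simp: F_def)
    show "h \<in> polys J" unfolding h_def using J3 by (intro polys_prod polys.add polys.var polys.const)
    have h: "h y \<noteq> 0 \<longleftrightarrow> (\<forall>i j. i \<noteq> j \<longrightarrow> y (True, m, i, i) + d i \<noteq> d j)" for y
      by (auto simp: h_def prod_fun_apply fun_arith_apply algebra_simps add_eq_0_iff2 eq_neg_iff_add_eq_0)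
    show "h (\<lambda>_. 0) \<noteq> 0" unfolding h using d by (auto simp: inj_eq)
    fix y c
    assume zero: "\<And>f. f \<in> F \<Longrightarrow> f y = 0" and "h y \<noteq> 0" and c: "c \<in> J"
    have "\<forall>s\<in>S. s (V y) = s (W y)" using zero by (force simp: F_def)
    then have inv: "\<forall>f\<in>invariants. f (V y) = f (W y)" using S(1) by (auto simp: separating_set_def)
    have same: "same_traces (V y) (W y)"
      unfolding same_traces_def using bspec[OF inv trace_equivariant] by blast
    have Vk: "V y $ m = diag_mat d" by (simp add: V_def diag_mat_def vec_eq_iff)
    have Wk: "W y $ m = diag_mat (\<lambda>i. d i + y (True, m, i, i))" by (simp add: W_def diag_mat_def vec_eq_iff)
    have y: "y (True, m, i, i) = 0" for i
    proof -
      obtain j where "d i + y (True, m, i, i) = d j"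
        using same_traces_range_diag[OF same Vk Wk] by (auto simp: image_subset_iff)
      moreover have "j = i" using calculation \<open>h y \<noteq> 0\<close> unfolding h by (metis add.commute)
      ultimately show ?thesis by simp
    qed
    then have Wk: "W y $ m = diag_mat d" using Wk by simp
    have low: "(\<forall>k i j. k \<noteq> m \<longrightarrow> \<rho> j < \<rho> i \<longrightarrow> V y $ k $ i $ j = 0) \<and>
      (\<forall>k i j. k \<noteq> m \<longrightarrow> \<rho>' j < \<rho>' i \<longrightarrow> W y $ k $ i $ j = 0)"
      by (rule rigid[OF same Vk Wk]) (simp_all add: V_def W_def)
    have diag: "W y $ k $ i $ i = 0" if "k \<noteq> m" for k i
      using same_traces_diag[OF same d Vk Wk, of k i] that by (simp add: V_def)
    consider k i j where "c = (False, k, i, j)" "k \<noteq> m" "\<rho> j < \<rho> i"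
      | k i j where "c = (True, k, i, j)" "k \<noteq> m" "\<rho>' j \<le> \<rho>' i" | i where "c = (True, m, i, i)"
      using c by (auto simp: J_def J1_def J2_def J3_def) blast+
    then show "y c = 0"
    proof cases
      case (1 k i j)
      then have "V y $ k $ i $ j = 0" using low by blast
      then show ?thesis using 1 by (auto simp: V_def split: if_splits)
    next
      case (2 k i j)
      then have "W y $ k $ i $ j = 0" using low diag \<rho>(2) by (metis inj_eq le_neq_implies_less)
      then show ?thesis using 2 by (auto simp: W_def split: if_splits)
    next
      case 3
      then show ?thesis using y by simp
    qed
  qed
  then show ?thesis using F cardJ by simp
qed

text \<open>
  The path of \<open>R\<^sub>a\<close> runs through the labels in increasing order, that of \<open>R\<^sub>b\<close> first through the odd
  and then through the even ones. A nontrivial strong component common to both relations would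
  contain 1 and 3, but \<open>R\<^sub>b\<close> relates these and \<open>R\<^sub>a\<close> does not.
\<close>

lemma interleaved_orders_acyclic:
  fixes \<tau> :: "nat \<Rightarrow> 'a" and p :: nat
  defines "\<sigma> r \<equiv> if odd r then r else p + r"
  assumes p: "4 \<le> p"
    and a1: "\<And>r. Suc r < p \<Longrightarrow> (\<tau> r, \<tau> (Suc r)) \<in> Ra"
    and a2: "\<And>r s. Suc r < s \<Longrightarrow> s < p \<Longrightarrow> (\<tau> r, \<tau> s) \<notin> Ra"
    and b: "\<And>r s. r < p \<Longrightarrow> s < p \<Longrightarrow> \<sigma> r < \<sigma> s \<Longrightarrow> (\<tau> r, \<tau> s) \<in> Rb"
    and ab: "\<And>x y. (x, y) \<in> Ra \<Longrightarrow> (y, x) \<in> Ra\<^sup>* \<Longrightarrow> (x, y) \<in> Rb \<and> (y, x) \<in> Rb\<^sup>*"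
    and ba: "\<And>x y. (x, y) \<in> Rb \<Longrightarrow> (y, x) \<in> Rb\<^sup>* \<Longrightarrow> (x, y) \<in> Ra \<and> (y, x) \<in> Ra\<^sup>*"
  shows "\<And>r s. r < s \<Longrightarrow> s < p \<Longrightarrow> (\<tau> s, \<tau> r) \<notin> Ra"
    and "\<And>r s. r < p \<Longrightarrow> s < p \<Longrightarrow> \<sigma> r < \<sigma> s \<Longrightarrow> (\<tau> s, \<tau> r) \<notin> Rb"
proof -
  have apath: "(\<tau> r, \<tau> s) \<in> Ra\<^sup>*" if "r \<le> s" "s < p" for r s
    using that
  proof (induction s rule: dec_induct)
    case base
    then show ?case by simp
  next
    case (step s)
    then show ?case using a1[of s] by (meson Suc_lessD rtrancl.rtrancl_into_rtrancl)
  qed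
  have bpath: "(\<tau> r, \<tau> s) \<in> Rb\<^sup>*" if "r < p" "s < p" "\<sigma> r \<le> \<sigma> s" for r s
  proof (cases "r = s")
    case False
    then have "\<sigma> r < \<sigma> s" using that unfolding \<sigma>_def by (auto split: if_splits)
    then show ?thesis using b that by blast
  qed simp
  have core: False if oe: "odd r" "even s" "r < p" "s < p" "(\<tau> s, \<tau> r) \<in> Rb\<^sup>*" for r s
  proof -
    \<comment> \<open>The largest odd label. In the second order it ends the odd block and 0 begins
      the even one, so a path from an even to an odd label closes a cycle through the arc from
      \<open>q\<close> to 0. That arc must then belong to \<open>Ra\<close>, where it closes the
      path 0, 1, ..., q to a cycle.\<close>
    define q where "q = (if even p then p - 1 else p - 2)"
    have q: "odd q" "q < p" "3 \<le> q" using p unfolding q_def by (auto, presburger+)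
    have "r \<le> q" using oe unfolding q_def by (auto, presburger+)
    then have "(\<tau> r, \<tau> q) \<in> Rb\<^sup>*" using oe q by (intro bpath) (auto simp: \<sigma>_def)
    moreover have "(\<tau> 0, \<tau> s) \<in> Rb\<^sup>*" using oe by (intro bpath) (auto simp: \<sigma>_def)
    ultimately have "(\<tau> 0, \<tau> q) \<in> Rb\<^sup>*" using oe by (meson rtrancl_trans)
    moreover have "(\<tau> q, \<tau> 0) \<in> Rb" using q by (intro b) (auto simp: \<sigma>_def)
    ultimately have "(\<tau> q, \<tau> 0) \<in> Ra" using ba by blast
    then have cyc: "(\<tau> (Suc i), \<tau> i) \<in> Ra\<^sup>*" if "Suc i \<le> q" for i
      using apath[of "Suc i" q] apath[of 0 i] that q by (meson Suc_leD le0 le_less_trans converse_rtrancl_into_rtrancl rtrancl_trans)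
    \<comment> \<open>The arcs of this cycle return to \<open>Rb\<close>, which now leads back from
      3 to 1. With the arc from 1 to 3 this is a cycle in \<open>Rb\<close>, but \<open>Ra\<close>
      lacks that arc.\<close>
    have "(\<tau> (Suc i), \<tau> i) \<in> Rb\<^sup>*" if "Suc i \<le> q" for i
      using ab[OF a1 cyc] that q by auto
    from this[of 1] this[of 2] have "(\<tau> 3, \<tau> 1) \<in> Rb\<^sup>*" using q by (simp add: eval_nat_numeral)
    moreover have "(\<tau> 1, \<tau> 3) \<in> Rb" using q p by (intro b) (auto simp: \<sigma>_def)
    ultimately have "(\<tau> 1, \<tau> 3) \<in> Ra" using ba by blast
    then show False using a2[of 1 3] p by simp
  qed
  show "(\<tau> s, \<tau> r) \<notin> Ra" if "r < s" "s < p" for r s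
  proof
    assume "(\<tau> s, \<tau> r) \<in> Ra"
    \<comment> \<open>The backward arc puts the arc from r to r + 1 on a cycle, so \<open>Rb\<close>
      connects the two labels both ways. They have opposite parity, and one direction leads from
      even to odd, contrary to \<open>core\<close>.\<close>
    then have "(\<tau> (Suc r), \<tau> r) \<in> Ra\<^sup>*" using apath[of "Suc r" s] that by (meson Suc_leI rtrancl.rtrancl_into_rtrancl)
    then have "(\<tau> r, \<tau> (Suc r)) \<in> Rb" "(\<tau> (Suc r), \<tau> r) \<in> Rb\<^sup>*" using ab a1 that by (meson Suc_leI le_less_trans)+
    then show False using core[of r "Suc r"] core[of "Suc r" r] that by (cases "even r") auto
  qed
  show "(\<tau> s, \<tau> r) \<notin> Rb" if rs: "r < p" "s < p" "\<sigma> r < \<sigma> s" for r s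
  proof
    assume sr: "(\<tau> s, \<tau> r) \<in> Rb"
    have 1: "(\<tau> r, \<tau> s) \<in> Rb" using b rs by blast
    have Ra: "(\<tau> r, \<tau> s) \<in> Ra" "(\<tau> s, \<tau> r) \<in> Ra" using ba 1 sr by blast+
    have "r \<noteq> s" using rs by auto
    \<comment> \<open>Arcs in both directions exist in \<open>Ra\<close>, whose forward arcs join
      neighbours only. Neighbours have opposite parity, so in the second order the odd one comes
      first.\<close>
    then have "s = Suc r \<or> r = Suc s" using a2[of r s] a2[of s r] Ra rs by (metis Suc_lessI linorder_neqE_nat)
    then have "odd r" "even s" using rs unfolding \<sigma>_def by (auto split: if_splits)
    then show False using core sr rs by blast
  qed
qed

section \<open>The choice of the slice in the two cases\<close>

theorem theorem1p13:
  fixes S :: "(('n::finite, 'p::finite) mat_tuple \<Rightarrow> complex) set"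
  assumes "(CARD('n) \<ge> 3 \<and> CARD('p) \<ge> 2) \<or> (CARD('n) = 2 \<and> CARD('p) \<ge> 4)"
    and "separating_set S"
  shows "infinite S \<or> card S \<ge> (CARD('n) - 1) * CARD('p)^2 + CARD('p)"
proof (rule disjCI)
  assume "\<not> (CARD('n) - 1) * CARD('p)^2 + CARD('p) \<le> card S"
  moreover have "(CARD('n) - 1) * CARD('p)^2 + CARD('p) \<le> card S" if S: "finite S"
  proof -
    obtain \<rho> :: "'p \<Rightarrow> nat" where \<rho>: "bij_betw \<rho> UNIV {0..<CARD('p)}"
      using ex_bij_betw_finite_nat[of "UNIV :: 'p set"] by auto
    have inj: "inj \<rho>" using \<rho> by (simp add: bij_betw_def)
    define d where "d i = (of_nat (\<rho> i) :: complex)" for i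
    have d: "inj d" using inj by (auto simp: d_def inj_def)
    show ?thesis using assms(1)
    proof
      assume "3 \<le> CARD('n) \<and> 2 \<le> CARD('p)"
      then obtain T :: "'n set" where "card T = 3" using obtain_subset_with_card_n by blast
      then obtain k1 k2 k3 :: 'n where k: "k1 \<noteq> k2" "k1 \<noteq> k3" "k2 \<noteq> k3" by (auto simp: card_3_iff)
      show ?thesis
      proof (rule card_separating_set_ge[OF assms(2) S inj inj d,
            where m = k1 and u = "\<lambda>k i j. if k = k2 then 1 else 0" and u' = "\<lambda>k i j. if k = k3 then 1 else 0"])
        fix v w :: "('n, 'p) mat_tuple"
        assume same: "same_traces v w" and vw: "v $ k1 = diag_mat d" "w $ k1 = diag_mat d"
          and v: "\<And>k i j. k \<noteq> k1 \<Longrightarrow> \<rho> i < \<rho> j \<Longrightarrow> v $ k $ i $ j = (if k = k2 then 1 else 0)"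
          and w: "\<And>k i j. k \<noteq> k1 \<Longrightarrow> \<rho> i < \<rho> j \<Longrightarrow> w $ k $ i $ j = (if k = k3 then 1 else 0)"
        \<comment> \<open>Above the diagonal, matrix \<open>k2\<close> has entry 1 in
          \<open>v\<close> and 0 in \<open>w\<close>, so a 2-cycle through it equates the lower
          entry of \<open>v\<close> with 0; \<open>k3\<close> does the same for
          \<open>w\<close>.\<close>
        have "v $ k $ i $ j = 0 \<and> w $ k $ i $ j = 0" if "\<rho> j < \<rho> i" for k i j
          using same_traces_2cycle[OF same d vw, of k2 j i k] same_traces_2cycle[OF same d vw, of k3 j i k]
            v[OF _ that] w[OF _ that] k by simp
        then show "(\<forall>k i j. k \<noteq> k1 \<longrightarrow> \<rho> j < \<rho> i \<longrightarrow> v $ k $ i $ j = 0) \<and>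
            (\<forall>k i j. k \<noteq> k1 \<longrightarrow> \<rho> j < \<rho> i \<longrightarrow> w $ k $ i $ j = 0)" by blast
      qed
    next
      assume np: "CARD('n) = 2 \<and> 4 \<le> CARD('p)"
      then obtain k1 k2 :: 'n where k: "UNIV = {k1, k2}" "k1 \<noteq> k2" by (auto simp: card_2_iff)
      define \<sigma> where "\<sigma> r = (if odd r then r else CARD('p) + r)" for r
      have \<rho>_less: "\<rho> i < CARD('p)" for i using \<rho> by (auto simp: bij_betw_def)
      have inj': "inj (\<lambda>i. \<sigma> (\<rho> i))"
      proof (rule injI)
        fix i j assume "\<sigma> (\<rho> i) = \<sigma> (\<rho> j)"
        then have "\<rho> i = \<rho> j" using \<rho>_less[of i] \<rho>_less[of j] by (auto simp: \<sigma>_def split: if_splits)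
        then show "i = j" using inj by (simp add: inj_eq)
      qed
      define \<tau> where "\<tau> = inv \<rho>"
      have \<tau>: "\<tau> (\<rho> i) = i" for i using inj by (simp add: \<tau>_def)
      have \<rho>\<tau>: "\<rho> (\<tau> r) = r" if "r < CARD('p)" for r
        using that \<rho> unfolding \<tau>_def by (intro f_inv_into_f) (auto simp: bij_betw_def)
      show ?thesis
      \<comment> \<open>In \<open>v\<close> only neighbouring labels are joined above the diagonal,
        in \<open>w\<close> all pairs that its order allows. The arc from 1 to 3, which separates
        the two patterns, exists because there are at least four labels.\<close>
      proof (rule card_separating_set_ge[OF assms(2) S inj inj' d,
            where m = k1 and u = "\<lambda>k i j. if \<rho> j = Suc (\<rho> i) then 1 else 0" and u' = "\<lambda>k i j. 1"])
        fix v w :: "('n, 'p) mat_tuple"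
        assume same: "same_traces v w" and vw: "v $ k1 = diag_mat d" "w $ k1 = diag_mat d"
          and v: "\<And>k i j. k \<noteq> k1 \<Longrightarrow> \<rho> i < \<rho> j \<Longrightarrow> v $ k $ i $ j = (if \<rho> j = Suc (\<rho> i) then 1 else 0)"
          and w: "\<And>k i j. k \<noteq> k1 \<Longrightarrow> \<sigma> (\<rho> i) < \<sigma> (\<rho> j) \<Longrightarrow> w $ k $ i $ j = 1"
        define Ra where "Ra = {(i, j). v $ k2 $ i $ j \<noteq> 0}"
        define Rb where "Rb = {(i, j). w $ k2 $ i $ j \<noteq> 0}"
        have p: "4 \<le> CARD('p)" using np by simp
        have a1: "(\<tau> r, \<tau> (Suc r)) \<in> Ra" if "Suc r < CARD('p)" for r
          using v[of k2 "\<tau> r" "\<tau> (Suc r)"] that k by (simp add: Ra_def \<rho>\<tau>)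
        have a2: "(\<tau> r, \<tau> s) \<notin> Ra" if "Suc r < s" "s < CARD('p)" for r s
          using v[of k2 "\<tau> r" "\<tau> s"] that k by (simp add: Ra_def \<rho>\<tau>)
        have b: "(\<tau> r, \<tau> s) \<in> Rb" if "r < CARD('p)" "s < CARD('p)" "\<sigma> r < \<sigma> s" for r s
          using w[of k2 "\<tau> r" "\<tau> s"] that k by (simp add: Rb_def \<rho>\<tau>)
        have ab: "(x, y) \<in> Rb \<and> (y, x) \<in> Rb\<^sup>*" if "(x, y) \<in> Ra" "(y, x) \<in> Ra\<^sup>*" for x y
          using same_traces_cycle[OF same d vw, of x y k2] that unfolding Ra_def Rb_def by blast
        have ba: "(x, y) \<in> Ra \<and> (y, x) \<in> Ra\<^sup>*" if "(x, y) \<in> Rb" "(y, x) \<in> Rb\<^sup>*" for x y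
          using same_traces_cycle[OF same_traces_sym[OF same] d vw(2,1), of x y k2] that
          unfolding Ra_def Rb_def by blast
        have acyclic1: "(\<tau> s, \<tau> r) \<notin> Ra" if "r < s" "s < CARD('p)" for r s
          by (rule interleaved_orders_acyclic(1)[OF p, of \<tau> Ra Rb])
            (rule a1 a2 b[unfolded \<sigma>_def] ab ba that; assumption)+
        have acyclic2: "(\<tau> s, \<tau> r) \<notin> Rb" if "r < CARD('p)" "s < CARD('p)" "\<sigma> r < \<sigma> s" for r s
          by (rule interleaved_orders_acyclic(2)[OF p, of \<tau> Ra Rb])
            (rule a1 a2 b[unfolded \<sigma>_def] ab ba that[unfolded \<sigma>_def]; assumption)+
        have k2: "k = k2" if "k \<noteq> k1" for k using that k by auto
        have "v $ k $ i $ j = 0" if "k \<noteq> k1" "\<rho> j < \<rho> i" for k i j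
          using acyclic1[OF that(2) \<rho>_less] k2[OF that(1)] by (simp add: \<tau> Ra_def)
        moreover have "w $ k $ i $ j = 0" if "k \<noteq> k1" "\<sigma> (\<rho> j) < \<sigma> (\<rho> i)" for k i j
          using acyclic2[OF \<rho>_less \<rho>_less that(2)] k2[OF that(1)] by (simp add: \<tau> Rb_def)
        ultimately show "(\<forall>k i j. k \<noteq> k1 \<longrightarrow> \<rho> j < \<rho> i \<longrightarrow> v $ k $ i $ j = 0) \<and>
            (\<forall>k i j. k \<noteq> k1 \<longrightarrow> \<sigma> (\<rho> j) < \<sigma> (\<rho> i) \<longrightarrow> w $ k $ i $ j = 0)" by blast
      qed
    qed
  qed
  ultimately show "infinite S" by blast
qed

end
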